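(* Let $S \subset [m] \times [n]$, let $\mathcal{M}_S$ be the associated quasi-independence model, and let $G_S$ be the bipartite graph associated to $S$. Then $\mathcal{M}_S$ has rational maximum likelihood estimate if and only if $G_S$ is doubly chordal bipartite.
   Context: Notation: $[k] = \{1,\dots,k\}$; $\mathbb{R}^S$ is the real vector space with coordinates indexed by $S$; $\Delta_{r-1} = \{x \in \mathbb{R}^r \mid x_i > 0 \text{ for all } i,\ \sum_i x_i = 1\}$ is the open probability simplex. Quasi-independence model: define $\phi^S : \mathbb{R}^{m+n} \to \mathbb{R}^S$ by $\phi^S_{ij}(s_1,\dots,s_m,t_1,\dots,t_n) = s_i t_j$ for $(i,j)\in S$. Then $\mathcal{M}_S := \phi^S(\mathbb{R}^{m+n}) \cap \Delta_{\#S-1}$. Graph: $G_S$ is the bipartite graph with independent sets $[m]$ and $[n]$ (regarded as disjoint) and an edge between $i \in [m]$ and $j\in[n]$ if and only if $(i,j) \in S$. A bipartite graph is doubly chordal bipartite if every cycle of length at least $6$ has at least two chords. Maximum likelihood: for a vector of counts $u \in \mathbb{N}^S$, the maximum likelihood estimate (MLE) for $u$ in $\mathcal{M}_S$ is the distribution $\hat p \in \mathcal{M}_S$ maximizing $L(p\mid u) = \prod_{(i,j)\in S} p_{ij}^{u_{ij}}$ over $p \in \mathcal{M}_S$. The model $\mathcal{M}_S$ has rational MLE if, for generic $u$, the coordinates of the MLE for $u$ are given by rational functions of the entries of $u$. *)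

theory Defs
  imports Complex_Main "HOL-Library.FuncSet" "HOL-Library.Poly_Mapping"
begin

text \<open>
  The set $[k]$ is \<open>{1..k}\<close>. Vectors with coordinates indexed by a set \<open>A\<close> are
  the extensional functions \<open>A \<rightarrow>\<^sub>E UNIV\<close>, so that two vectors are equal iff
  their coordinates in \<open>A\<close> agree.
\<close>

section \<open>Quasi-independence models\<close>

definition open_simplex :: "'i set \<Rightarrow> ('i \<Rightarrow> real) set" where
  "open_simplex I = {x \<in> I \<rightarrow>\<^sub>E UNIV. (\<forall>i\<in>I. x i > 0) \<and> (\<Sum>i\<in>I. x i) = 1}"

definition qi_param ::
    "(nat \<times> nat) set \<Rightarrow> (nat \<Rightarrow> real) \<times> (nat \<Rightarrow> real) \<Rightarrow> nat \<times> nat \<Rightarrow> real" where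
  "qi_param S = (\<lambda>(s, t). \<lambda>(i, j)\<in>S. s i * t j)"

definition qi_model :: "nat \<Rightarrow> nat \<Rightarrow> (nat \<times> nat) set \<Rightarrow> (nat \<times> nat \<Rightarrow> real) set" where
  "qi_model m n S =
     qi_param S ` (({1..m} \<rightarrow>\<^sub>E UNIV) \<times> ({1..n} \<rightarrow>\<^sub>E UNIV)) \<inter> open_simplex S"

section \<open>Polynomials in finitely many variables\<close>

text \<open>
  A polynomial is a finitely supported map from monomials to coefficients, a
  monomial a finitely supported map from variables to exponents.
\<close>

type_synonym 'x real_mpoly = "('x \<Rightarrow>\<^sub>0 nat) \<Rightarrow>\<^sub>0 real"

definition mpolys_in :: "'x set \<Rightarrow> 'x real_mpoly set" where
  "mpolys_in X = {f. \<forall>a \<in> Poly_Mapping.keys f. Poly_Mapping.keys a \<subseteq> X}"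

definition mpoly_eval :: "'x real_mpoly \<Rightarrow> ('x \<Rightarrow> real) \<Rightarrow> real" where
  "mpoly_eval f v = (\<Sum>a \<in> Poly_Mapping.keys f. Poly_Mapping.lookup f a *
     (\<Prod>x \<in> Poly_Mapping.keys a. v x ^ Poly_Mapping.lookup a x))"

section \<open>Maximum likelihood estimation\<close>

definition likelihood :: "'i set \<Rightarrow> ('i \<Rightarrow> nat) \<Rightarrow> ('i \<Rightarrow> real) \<Rightarrow> real" where
  "likelihood I u p = (\<Prod>i\<in>I. p i ^ u i)"

definition is_mle :: "'i set \<Rightarrow> ('i \<Rightarrow> real) set \<Rightarrow> ('i \<Rightarrow> nat) \<Rightarrow> ('i \<Rightarrow> real) \<Rightarrow> bool" where
  "is_mle I M u p \<longleftrightarrow> is_arg_max (likelihood I u) (\<lambda>q. q \<in> M) p"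

text \<open>
  A property of vectors of counts is generic if it holds off the zero set of some
  nonzero polynomial. The polynomial may only use the coordinates in \<open>I\<close>, hence
  it cannot vanish on all vectors of counts.
\<close>

definition for_generic_counts :: "'i set \<Rightarrow> (('i \<Rightarrow> nat) \<Rightarrow> bool) \<Rightarrow> bool" where
  "for_generic_counts I P \<longleftrightarrow>
     (\<exists>h \<in> mpolys_in I. h \<noteq> 0 \<and>
        (\<forall>u \<in> I \<rightarrow>\<^sub>E UNIV. mpoly_eval h (\<lambda>i. real (u i)) \<noteq> 0 \<longrightarrow> P u))"

text \<open>
  For generic counts the MLE exists, is unique, and its coordinate at each
  \<open>i \<in> I\<close> is \<open>f i / g i\<close>. Existence is stated per coordinate, which makes a
  difference only for \<open>I = {}\<close>: then the open simplex and every model in it are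
  empty, there are no coordinates, and the condition holds.
\<close>

definition has_rational_mle :: "'i set \<Rightarrow> ('i \<Rightarrow> real) set \<Rightarrow> bool" where
  "has_rational_mle I M \<longleftrightarrow>
     (\<exists>f \<in> I \<rightarrow> mpolys_in I. \<exists>g \<in> I \<rightarrow> mpolys_in I.
        for_generic_counts I (\<lambda>u. \<forall>i\<in>I.
          mpoly_eval (g i) (\<lambda>k. real (u k)) \<noteq> 0 \<and>
          (\<exists>p. {q. is_mle I M u q} = {p} \<and>
             p i = mpoly_eval (f i) (\<lambda>k. real (u k)) / mpoly_eval (g i) (\<lambda>k. real (u k)))))"

section \<open>Doubly chordal bipartite graphs\<close>

text \<open>A graph is given by its vertex set and its set of edges, which are two-element sets.\<close>

type_synonym 'v ugraph = "'v set \<times> 'v set set"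

definition qi_graph :: "nat \<Rightarrow> nat \<Rightarrow> (nat \<times> nat) set \<Rightarrow> (nat + nat) ugraph" where
  "qi_graph m n S = ({1..m} <+> {1..n}, {{Inl i, Inr j} | i j. (i, j) \<in> S})"

definition bipartite :: "'v ugraph \<Rightarrow> bool" where
  "bipartite G \<longleftrightarrow> (\<exists>A B. A \<union> B = fst G \<and> A \<inter> B = {} \<and>
     (\<forall>e \<in> snd G. \<exists>a\<in>A. \<exists>b\<in>B. e = {a, b}))"

definition cycle_edges :: "'v list \<Rightarrow> 'v set set" where
  "cycle_edges c = {{c ! k, c ! (Suc k mod length c)} | k. k < length c}"

text \<open>A cycle is listed by its vertices, without repeating the first one at the end.\<close>

definition is_cycle :: "'v ugraph \<Rightarrow> 'v list \<Rightarrow> bool" where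
  "is_cycle G c \<longleftrightarrow>
     length c \<ge> 3 \<and> distinct c \<and> set c \<subseteq> fst G \<and> cycle_edges c \<subseteq> snd G"

definition chords :: "'v ugraph \<Rightarrow> 'v list \<Rightarrow> 'v set set" where
  "chords G c = {e \<in> snd G. e \<subseteq> set c \<and> e \<notin> cycle_edges c}"

definition doubly_chordal_bipartite :: "'v ugraph \<Rightarrow> bool" where
  "doubly_chordal_bipartite G \<longleftrightarrow>
     bipartite G \<and> (\<forall>c. is_cycle G c \<and> length c \<ge> 6 \<longrightarrow> card (chords G c) \<ge> 2)"

end

(*
The model is a log-linear model, so by Birch's theorem the MLE is the point of the model with
the same margins as the data. A bipartite graph is doubly chordal iff it is distance hereditary,
i.e. it has no chordless cycle of length at least 6 and no domino (two 4-cycles sharing an edge).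
Such a graph has a pendant vertex or a pair of twins; at a pendant vertex the estimate equals the
count, and twins can be merged into one vertex whose estimate is then split proportionally to
their margins, so by induction the estimate is rational.

Conversely, put counts c * t^d on the edges of an induced long cycle or domino, with d = 0 on the
other edges, and let t tend to infinity. For suitable exponents d the estimated count of one edge
grows like sqrt t, that is, it is neither bounded nor of at least linear growth, which is
impossible for a rational function of t. The coefficients c keep the curve off the exceptional
hypersurface.
*)

theory Submission
  imports Defs "HOL-Computational_Algebra.Polynomial"
begin

text \<open>The square root comes from a quadratic equation. Along a chordless cycle the margins
  make estimate minus count alternate in sign up to a bounded error, so a single unknown deviation
  is left; it is fixed by the equality between the product over the even edges and the product over
  the odd edges. The exponents leave exactly two even edges with bounded counts, so that the
  deviation enters squared, and balance the other edges so that this square is of order t. In the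
  domino the same happens in one of the two squares, while the other one keeps the shared edge of
  order 1. The rest of the graph disturbs the margins of the pattern only by a constant, because its
  edges have counts independent of t.

  In the other direction the denominators are the obstacle. All rational functions in the induction
  are therefore quotients of polynomials that are positive at positive arguments. The resulting
  formula holds for all positive counts, and genericity only has to exclude zero counts.\<close>

text \<open>\<open>C\<close> lists the chords \<open>(i, j)\<close> of the cycle \<open>v 0, ..., v (L - 1)\<close> with \<open>i < j\<close>.\<close>

definition cycle_with_chords ::
    "('v \<Rightarrow> 'v \<Rightarrow> bool) \<Rightarrow> (nat \<Rightarrow> 'v) \<Rightarrow> nat \<Rightarrow> (nat \<times> nat) set \<Rightarrow> bool" where
  "cycle_with_chords E v L C \<longleftrightarrow> inj_on v {..<L} \<and>
     (\<forall>i j. i < j \<and> j < L \<longrightarrow>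
       (E (v i) (v j) \<longleftrightarrow> j = Suc i \<or> (i = 0 \<and> Suc j = L) \<or> (i, j) \<in> C))"

text \<open>For bipartite graphs these forbidden induced subgraphs characterise distance hereditary
  graphs.\<close>

definition distance_hereditary :: "('v \<Rightarrow> 'v \<Rightarrow> bool) \<Rightarrow> bool" where
  "distance_hereditary E \<longleftrightarrow>
     (\<forall>v L. 6 \<le> L \<longrightarrow> \<not> cycle_with_chords E v L {}) \<and>
     (\<forall>v. \<not> cycle_with_chords E v 6 {(0, 3)})"

section \<open>Structure of bipartite distance hereditary graphs\<close>

locale bipartite_adjacency =
  fixes E :: "'v \<Rightarrow> 'v \<Rightarrow> bool" and side :: "'v \<Rightarrow> bool"
  assumes sym: "E u v \<Longrightarrow> E v u"
    and side: "E u v \<Longrightarrow> side u \<noteq> side v"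
begin

text \<open>Seven edges and two non-edges settle all nine pairs across the bipartition; pairs on one
  side are never adjacent, and vertices on one side are distinct because some listed pair separates
  their neighbourhoods.\<close>

lemma domino_cycle:
  assumes "E a b" "E b c" "E c d" "E d e" "E e f" "E f a" "E a d" "\<not> E b e" "\<not> E c f"
  shows "\<exists>v. cycle_with_chords E v 6 {(0, 3)}"
proof
  let ?v = "\<lambda>k. [a, b, c, d, e, f] ! k"
  have s: "side b = (\<not> side a)" "side c = side a" "side d = (\<not> side a)" "side e = side a"
      "side f = (\<not> side a)"
    using side[OF assms(1)] side[OF assms(2)] side[OF assms(3)] side[OF assms(4)] side[OF assms(5)] by auto
  have ne: "a \<noteq> c" "a \<noteq> e" "c \<noteq> e" "b \<noteq> d" "b \<noteq> f" "d \<noteq> f"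
    using assms(1,3,6,8,9) assms(2,4) sym by blast+
  have ne': "x \<noteq> y" if "side x \<noteq> side y" for x y using that by auto
  have nE: "\<not> E x y" if "side x = side y" for x y using that side by blast
  have ns: "\<not> E a c" "\<not> E a e" "\<not> E c e" "\<not> E b d" "\<not> E b f" "\<not> E d f"
    using nE s by auto
  have af: "E a f" using assms(6) by (rule sym)
  have dist: "distinct [a, b, c, d, e, f]"
    using ne ne' s by auto
  have inj: "inj_on ?v {..<6}"
    using dist by (auto simp: inj_on_def nth_eq_iff_index_eq)
  have "E (?v i) (?v j) \<longleftrightarrow> j = Suc i \<or> (i = 0 \<and> Suc j = 6) \<or> (i, j) \<in> {(0, 3)}"
    if "i < j" "j < 6" for i j
  proof -
    have "j = 1 \<or> j = 2 \<or> j = 3 \<or> j = 4 \<or> j = 5" using that by auto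
    moreover have "i = 0 \<or> i = 1 \<or> i = 2 \<or> i = 3 \<or> i = 4" using that by auto
    ultimately show ?thesis using that(1)
      by (elim disjE) (simp_all add: numeral_eq_Suc assms ns af del: One_nat_def)
  qed
  then show "cycle_with_chords E ?v 6 {(0, 3)}"
    unfolding cycle_with_chords_def using inj by blast
qed

text \<open>A shortest walk from \<open>w\<close> to \<open>w'\<close> through \<open>A\<close>, closed up by \<open>x\<close>, is a chordless cycle.\<close>

lemma common_neighbour_through:
  assumes dh: "distance_hereditary E"
    and xw: "E x w" "E x w'" "w \<noteq> w'"
    and xA: "x \<notin> A" "\<And>z. z \<in> A \<Longrightarrow> \<not> E x z"
    and conn: "(w, w') \<in> {(u, v). E u v \<and> u \<in> insert w (insert w' A) \<and> v \<in> insert w (insert w' A)}\<^sup>*"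
      (is "_ \<in> ?G\<^sup>*")
  shows "\<exists>z\<in>A. E w z \<and> E w' z"
proof -
  define n where "n = (LEAST n. (w, w') \<in> ?G ^^ n)"
  have "(w, w') \<in> ?G ^^ n"
    unfolding n_def using conn rtrancl_imp_relpow by (metis (mono_tags, lifting) LeastI)
  then obtain v where v0: "v 0 = w" and vn: "v n = w'" and vG: "\<And>i. i < n \<Longrightarrow> (v i, v (Suc i)) \<in> ?G"
    by (auto simp only: relpow_fun_conv)
  have least: "n \<le> k" if "(w, w') \<in> ?G ^^ k" for k
    unfolding n_def using that by (rule Least_le)
  have seg: "(v i, v (i + k)) \<in> ?G ^^ k" if "i + k \<le> n" for i k
    unfolding relpow_fun_conv
    by (rule exI[of _ "\<lambda>l. v (i + l)"]) (use that vG in auto)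
  have B: "v i \<in> insert w (insert w' A)" if "i \<le> n" for i
  proof (cases "i < n")
    case True then show ?thesis using vG[of i] by auto
  next
    case False then show ?thesis using that vn by auto
  qed
  have inj: False if "i < j" "j \<le> n" "v i = v j" for i j
  proof -
    have "(w, v i) \<in> ?G ^^ i" using seg[of 0 i] that v0 by simp
    moreover have "(v i, w') \<in> ?G ^^ (n - j)" using seg[of j "n - j"] that vn by simp
    ultimately have "(w, w') \<in> ?G ^^ (i + (n - j))" by (auto simp: relpow_add simp del: relpow.simps)
    from least[OF this] show False using that by simp
  qed
  have E: "E (v i) (v j) \<longleftrightarrow> j = Suc i" if "i < j" "j \<le> n" for i j
  proof
    assume e: "E (v i) (v j)"
    then have g: "(v i, v j) \<in> ?G ^^ 1" using B[of i] B[of j] that by auto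
    have "(w, v i) \<in> ?G ^^ i" using seg[of 0 i] that v0 by simp
    moreover have "(v j, w') \<in> ?G ^^ (n - j)" using seg[of j "n - j"] that vn by simp
    ultimately have "(w, w') \<in> ?G ^^ (i + (1 + (n - j)))" using g
      by (auto simp only: relpow_add intro: relcompI)
    from least[OF this] show "j = Suc i" using that by simp
  next
    assume "j = Suc i" then show "E (v i) (v j)" using vG[of i] that by auto
  qed
  have vE: "E (v i) (v (Suc i))" if "i < n" for i
    using vG[OF that] by simp
  have n0: "n \<noteq> 0" using v0 vn xw(3) by (intro notI) simp
  have sw: "side w = side w'" using xw side by metis
  have n1: "n \<noteq> 1" using E[of 0 1] v0 vn sw side by auto
  have A: "v i \<in> A" if "0 < i" "i < n" for i
    using B[of i] inj[of 0 i] inj[of i n] that v0 vn by auto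
  \<comment> \<open>Parity: \<open>w\<close> and \<open>w'\<close> lie on the same side. For
    \<open>n\<close> at least 4 the closed walk has length \<open>n + 2\<close>, which is at least
    6.\<close>
  have n3: "n \<noteq> 3"
  proof
    assume n: "n = 3"
    then have "E (v 0) (v 1)" "E (v 1) (v 2)" "E (v 2) (v 3)"
      using vE[of 0] vE[of 1] vE[of 2] by (simp_all add: numeral_2_eq_2 numeral_3_eq_3)
    then have "side (v 0) \<noteq> side (v 3)"
      using side[of "v 0" "v 1"] side[of "v 1" "v 2"] side[of "v 2" "v 3"] by blast
    with v0 vn sw show False unfolding n by metis
  qed
  show ?thesis
  proof (cases "n = 2")
    case True
    then have "E w (v 1)" "E (v 1) w'" "v 1 \<in> A"
      using vE[of 0] vE[of 1] A[of 1] v0 vn by (simp_all add: numeral_2_eq_2)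
    then show ?thesis using sym by blast
  next
    case False
    then have n: "n \<ge> 4" using n0 n1 n3 by auto
    define c where "c k = (if k \<le> n then v k else x)" for k
    have xv: "x \<noteq> v i" if "i \<le> n" for i
    proof -
      have "x \<noteq> w" "x \<noteq> w'" using xw side by blast+
      then show ?thesis using B[OF that] xA by auto
    qed
    have Ex: "E (v i) x \<longleftrightarrow> i = 0 \<or> i = n" if "i \<le> n" for i
    proof (cases "0 < i \<and> i < n")
      case True then show ?thesis using A[of i] xA(2)[of "v i"] sym[of "v i" x] by auto
    next
      case False
      then have "i = 0 \<or> i = n" using that by auto
      then show ?thesis using sym[OF xw(1)] sym[OF xw(2)] v0 vn by auto
    qed
    have "inj_on c {..<n + 2}"
    proof (rule linorder_inj_onI)
      fix i j assume "i < j" "i \<in> {..<n + 2}" "j \<in> {..<n + 2}"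
      then show "c i \<noteq> c j"
        using inj[of i j] xv[of i] by (auto simp: c_def)
    qed auto
    moreover have "E (c i) (c j) \<longleftrightarrow> j = Suc i \<or> (i = 0 \<and> Suc j = n + 2) \<or> (i, j) \<in> {}"
      if "i < j" "j < n + 2" for i j
      using that E[of i j] Ex[of i] n by (auto simp: c_def)
    ultimately have "cycle_with_chords E c (n + 2) {}"
      unfolding cycle_with_chords_def by blast
    then show ?thesis using dh n unfolding distance_hereditary_def by (elim conjE) (erule allE[of _ c], erule allE[of _ "n + 2"], simp)
  qed
qed


subsection \<open>Distance levels\<close>

definition level :: "'v \<Rightarrow> nat \<Rightarrow> 'v set" where
  "level r k = {v. (r, v) \<in> {(u, v). E u v} ^^ k \<and> (\<forall>j<k. (r, v) \<notin> {(u, v). E u v} ^^ j)}"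

lemma level_0: "level r 0 = {r}"
  by (auto simp: level_def)

lemma level_disjoint: "v \<in> level r j \<Longrightarrow> v \<in> level r k \<Longrightarrow> j = k"
  unfolding level_def by (auto elim: linorder_neqE_nat)

lemma level_side: "v \<in> level r k \<Longrightarrow> side v \<longleftrightarrow> (side r \<longleftrightarrow> even k)"
proof -
  have "side v \<longleftrightarrow> (side r \<longleftrightarrow> even k)" if "(r, v) \<in> {(u, v). E u v} ^^ k" for v
    using that
  proof (induction k arbitrary: v)
    case (Suc k)
    then obtain u where "(r, u) \<in> {(u, v). E u v} ^^ k" "E u v" by auto
    then show ?case using Suc.IH side by auto
  qed auto
  then show "v \<in> level r k \<Longrightarrow> side v \<longleftrightarrow> (side r \<longleftrightarrow> even k)"
    by (simp add: level_def)
qed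

lemma walk_level:
  assumes "(r, v) \<in> {(u, v). E u v} ^^ k"
  shows "\<exists>j\<le>k. v \<in> level r j"
proof -
  define j where "j = (LEAST j. (r, v) \<in> {(u, v). E u v} ^^ j)"
  have "(r, v) \<in> {(u, v). E u v} ^^ j" "j \<le> k"
    unfolding j_def using assms by (auto intro: LeastI Least_le)
  moreover have "(r, v) \<notin> {(u, v). E u v} ^^ i" if "i < j" for i
    using that not_less_Least unfolding j_def by blast
  ultimately show ?thesis by (auto simp: level_def)
qed

lemma level_down:
  assumes "v \<in> level r (Suc k)"
  shows "\<exists>u\<in>level r k. E u v"
proof -
  obtain u where u: "(r, u) \<in> {(u, v). E u v} ^^ k" "E u v"
    using assms by (auto simp: level_def)
  obtain j where j: "j \<le> k" "u \<in> level r j" using walk_level[OF u(1)] by auto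
  have "(r, v) \<in> {(u, v). E u v} ^^ Suc j" using j u(2) by (auto simp: level_def)
  moreover have "(r, v) \<notin> {(u, v). E u v} ^^ i" if "i < Suc k" for i
    using assms that by (simp add: level_def del: relpow.simps)
  ultimately have "j = k" using j(1) by (metis Suc_less_eq le_neq_implies_less)
  with j u show ?thesis by auto
qed

text \<open>Walks in both directions bound the difference of levels by 1, and the bipartition
  excludes equality.\<close>

lemma level_up:
  assumes u: "u \<in> level r k" and e: "E u v"
  shows "v \<in> level r (Suc k) \<or> (\<exists>j. k = Suc j \<and> v \<in> level r j)"
proof -
  have "(r, v) \<in> {(u, v). E u v} ^^ Suc k" using assms by (auto simp: level_def)
  then obtain j where j: "j \<le> Suc k" "v \<in> level r j" using walk_level by blast
  have "(r, u) \<in> {(u, v). E u v} ^^ Suc j" using j e sym by (auto simp: level_def)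
  then obtain i where i: "i \<le> Suc j" "u \<in> level r i" using walk_level by blast
  have "i = k" using i u level_disjoint by blast
  moreover have "j \<noteq> k" using level_side[OF u] level_side[OF j(2)] side[OF e] by auto
  ultimately have "j = Suc k \<or> k = Suc j" using i j by auto
  then show ?thesis using j by auto
qed

text \<open>A shortest walk to \<open>v\<close> visits only lower levels before \<open>v\<close>,
  hence stays in \<open>B\<close>.\<close>

lemma level_connected:
  assumes "v \<in> level r k" "v \<in> B" "\<And>j. j < k \<Longrightarrow> level r j \<subseteq> B"
  shows "(r, v) \<in> {(u, v). E u v \<and> u \<in> B \<and> v \<in> B}\<^sup>*"
  using assms
proof (induction k arbitrary: v)
  case 0 then show ?case by (simp add: level_0)
next
  case (Suc k)
  obtain u where u: "u \<in> level r k" "E u v" using level_down[OF Suc.prems(1)] by auto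
  have uB: "u \<in> B" using u Suc.prems(3)[of k] by auto
  have "(r, u) \<in> {(u, v). E u v \<and> u \<in> B \<and> v \<in> B}\<^sup>*"
    using Suc.IH[OF u(1) uB] Suc.prems(3) by auto
  then show ?case using u uB Suc.prems(2) by (auto intro: rtrancl_into_rtrancl)
qed

text \<open>Levels up to \<open>k\<close> join \<open>w\<close> and \<open>w'\<close> through the
  root, and \<open>x\<close> is too far away to be adjacent to any of them. So
  \<open>common_neighbour_through\<close> yields a common neighbour there, and only level
  \<open>k\<close> is close enough to \<open>w\<close>.\<close>

lemma level_common_below:
  assumes dh: "distance_hereditary E"
    and w: "w \<in> level r (Suc k)" "w' \<in> level r (Suc k)" "w \<noteq> w'"
    and x: "x \<in> level r (Suc (Suc k))" "E x w" "E x w'"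
  shows "\<exists>z\<in>level r k. E w z \<and> E w' z"
proof -
  define A where "A = (\<Union>j\<le>k. level r j)"
  have xz: "\<not> E x z" if "z \<in> A" for z
  proof
    assume "E x z"
    from that obtain j where "z \<in> level r j" "j \<le> k" by (auto simp: A_def)
    with level_up[OF x(1) \<open>E x z\<close>] show False by (auto dest: level_disjoint)
  qed
  have xA: "x \<notin> A" using x(1) by (auto simp: A_def dest: level_disjoint)
  let ?B = "insert w (insert w' A)"
  let ?G = "{(u, v). E u v \<and> u \<in> ?B \<and> v \<in> ?B}"
  have "(r, w) \<in> ?G\<^sup>*" "(r, w') \<in> ?G\<^sup>*"
    by (rule level_connected[OF w(1)] level_connected[OF w(2)]; auto simp: A_def)+
  moreover have "sym ?G" using sym by (auto simp: sym_def)
  ultimately have "(w, w') \<in> ?G\<^sup>*"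
    by (meson rtrancl_trans sym_rtrancl symD)
  from common_neighbour_through[OF dh x(2,3) w(3) xA xz this]
  obtain z where z: "z \<in> A" "E w z" "E w' z" by auto
  then have "z \<in> level r k"
    using level_up[OF w(1) z(2)] by (auto simp: A_def dest: level_disjoint)
  then show ?thesis using z by auto
qed

text \<open>Induction on the distance from the root. A common lower neighbour \<open>z'\<close> of
  \<open>w\<close> and \<open>w'\<close> has the same neighbours below as \<open>z\<close>, since
  both lie under \<open>w\<close>. Were \<open>z\<close> not adjacent to \<open>w'\<close>, the
  hexagon \<open>w\<close>, \<open>x\<close>, \<open>w'\<close>, \<open>z'\<close>,
  \<open>y\<close>, \<open>z\<close> would be a domino whose middle edge joins \<open>w\<close> and
  \<open>z'\<close>.\<close>

lemma level_same_below:
  assumes dh: "distance_hereditary E"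
    and "w \<in> level r (Suc k)" "w' \<in> level r (Suc k)"
    and "x \<in> level r (Suc (Suc k))" "E x w" "E x w'"
    and "z \<in> level r k" "E w z"
  shows "E w' z"
  using assms(2-)
proof (induction k arbitrary: w w' x z)
  case 0
  then show ?case using level_down[of w' r 0] sym by (auto simp: level_0)
next
  case (Suc k)
  show ?case
  proof (rule ccontr)
    assume nz: "\<not> E w' z"
    then have "w \<noteq> w'" using Suc.prems by auto
    from level_common_below[OF dh Suc.prems(1,2) this Suc.prems(3-5)]
    obtain z' where z': "z' \<in> level r (Suc k)" "E w z'" "E w' z'" by auto
    obtain y where y: "y \<in> level r k" "E z y"
      using level_down[OF Suc.prems(6)] sym by auto
    have y': "E z' y"
      using Suc.IH[OF Suc.prems(6) z'(1) Suc.prems(1) Suc.prems(7) z'(2) y] .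
    have "\<not> E x y"
      using level_up[OF Suc.prems(3), of y] level_disjoint[OF y(1)] by fastforce
    from domino_cycle[of w x w' z' y z] this show False
      using Suc.prems z' y y' sym nz dh unfolding distance_hereditary_def by metis
  qed
qed

text \<open>A vertex \<open>y\<close> below \<open>w\<close> is by \<open>level_same_below\<close>
  adjacent to \<open>a\<close> and \<open>b\<close> too, so without the edge from \<open>x\<close>
  to \<open>b\<close> the hexagon \<open>w\<close>, \<open>x\<close>, \<open>a\<close>,
  \<open>y\<close>, \<open>b\<close>, \<open>x'\<close> is a domino. Hence lower neighbourhoods that
  meet are nested.\<close>

lemma level_laminar:
  assumes dh: "distance_hereditary E"
    and x: "x \<in> level r (Suc k)" "x' \<in> level r (Suc k)"
    and w: "w \<in> level r k" "E x w" "E x' w"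
    and a: "a \<in> level r k" "E x a" "\<not> E x' a"
    and b: "b \<in> level r k" "E x' b"
  shows "E x b"
proof (rule ccontr)
  assume nb: "\<not> E x b"
  \<comment> \<open>Level 0 has a single vertex, but \<open>w\<close> and \<open>a\<close>
    differ.\<close>
  obtain j where j: "k = Suc j"
    using w a level_0[of r] by (cases k) auto
  obtain y where y: "y \<in> level r j" "E w y" using level_down w(1) sym j by blast
  have ya: "E a y" using level_same_below[OF dh _ _ _ w(2) a(2) y] x w a j by auto
  have yb: "E b y" using level_same_below[OF dh _ _ _ w(3) b(2) y] x w b j by auto
  from domino_cycle[of w x a y b x'] show False
    using w a b y ya yb nb sym dh unfolding distance_hereditary_def by metis
qed

text \<open>On the last level take a vertex \<open>x\<close> with fewest neighbours: it is pendant, or any two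
  of its neighbours are twins.\<close>

theorem pendant_or_twins:
  assumes dh: "distance_hereditary E" and fin: "finite {v. \<exists>w. E v w}" and e: "E a b"
  shows "(\<exists>x y. E x y \<and> (\<forall>z. E x z \<longrightarrow> z = y)) \<or>
    (\<exists>x y z. x \<noteq> y \<and> E x z \<and> (\<forall>z. E x z \<longleftrightarrow> E y z))"
proof -
  have lev: "level a k \<subseteq> {v. \<exists>w. E v w}" for k
  proof (cases k)
    case 0 then show ?thesis using e by (auto simp: level_0)
  next
    case (Suc j) then show ?thesis using level_down[of _ a j] sym by blast
  qed
  have finl: "finite (level a k)" for k
    using lev fin finite_subset by blast
  have "finite {k. level a k \<noteq> {}}"
  proof (rule finite_surj[OF fin])
    show "{k. level a k \<noteq> {}} \<subseteq> (\<lambda>v. THE k. v \<in> level a k) ` {v. \<exists>w. E v w}"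
    proof
      fix k assume "k \<in> {k. level a k \<noteq> {}}"
      then obtain v where v: "v \<in> level a k" by auto
      then have "(THE k. v \<in> level a k) = k"
        by (rule the_equality) (rule level_disjoint[OF _ v])
      then show "k \<in> (\<lambda>v. THE k. v \<in> level a k) ` {v. \<exists>w. E v w}"
        by (rule image_eqI[OF HOL.sym]) (rule subsetD[OF lev v])
    qed
  qed
  define K where "K = Max {k. level a k \<noteq> {}}"
  have b: "b \<in> level a 1" using level_up[of a a 0 b] e by (auto simp: level_0)
  have K: "level a K \<noteq> {}" "\<And>k. level a k \<noteq> {} \<Longrightarrow> k \<le> K"
    using Max_in[of "{k. level a k \<noteq> {}}"] Max_ge[of "{k. level a k \<noteq> {}}"] b
      \<open>finite {k. level a k \<noteq> {}}\<close> unfolding K_def by auto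
  have "1 \<le> K" using K(2) b by auto
  then obtain k where k: "K = Suc k" by (cases K) auto
  have nb: "z \<in> level a k" if "x \<in> level a K" "E x z" for x z
    using level_up[OF that] K(2)[of "Suc K"] k by auto
  obtain x where x: "x \<in> level a K" and
      min: "\<And>x'. x' \<in> level a K \<Longrightarrow> card {z. E x z} \<le> card {z. E x' z}"
    using arg_min_if_finite[OF finl K(1), of "\<lambda>x. card {z. E x z}"] by (metis not_le)
  obtain w where w: "E x w" using level_down[of x a k] x k sym by auto
  show ?thesis
  proof (cases "\<forall>z. E x z \<longrightarrow> z = w")
    case True then show ?thesis using w by blast
  next
    case False
    then obtain w' where w': "E x w'" "w \<noteq> w'" by auto
    have wk: "w \<in> level a k" "w' \<in> level a k" using nb x w w' by auto
    then obtain j where j: "k = Suc j"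
      using w'(2) level_0[of a] by (cases k) auto
    \<comment> \<open>Below \<open>v\<close> this is \<open>level_same_below\<close> with
      \<open>x\<close> on top. Above \<open>v\<close>, a vertex \<open>z\<close> missed by
      \<open>v'\<close> has by \<open>level_laminar\<close> its neighbourhood strictly inside that
      of \<open>x\<close>, against the minimality of \<open>x\<close>.\<close>
    have half: "E v' z" if "E v z" "v \<in> level a k" "v' \<in> level a k" "E x v" "E x v'" for v v' z
      using level_up[OF that(2,1)]
    proof
      assume z: "z \<in> level a (Suc k)"
      show "E v' z"
      proof (rule ccontr)
        assume n: "\<not> E v' z"
        have "{y. E z y} \<subset> {y. E x y}"
        proof
          show "{y. E z y} \<subseteq> {y. E x y}"
          proof clarify
            fix y assume y: "E z y"
            show "E x y"
              by (rule level_laminar[OF dh, of x a k z v v'])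
                (use x z that n y sym k nb in auto)
          qed
          show "{y. E z y} \<noteq> {y. E x y}" using n that sym by auto
        qed
        moreover have "finite {y. E x y}"
          by (rule finite_subset[OF _ fin]) (use sym in auto)
        ultimately have "card {y. E z y} < card {y. E x y}" by (rule psubset_card_mono[rotated])
        then show False using min[of z] z k by auto
      qed
    next
      assume "\<exists>j. k = Suc j \<and> z \<in> level a j"
      then show "E v' z"
        using level_same_below[OF dh, of v a j v' x z] that x k j by auto
    qed
    have "E w z \<longleftrightarrow> E w' z" for z
      using half[of w z w'] half[of w' z w] wk w w' by auto
    then show ?thesis using w' sym[OF w] by blast
  qed
qed

end

section \<open>Polynomials\<close>

definition monomial_eval :: "('x \<Rightarrow>\<^sub>0 nat) \<Rightarrow> ('x \<Rightarrow> real) \<Rightarrow> real" where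
  "monomial_eval a v = (\<Prod>x \<in> Poly_Mapping.keys a. v x ^ Poly_Mapping.lookup a x)"

lemma monomial_eval_superset:
  assumes "finite X" "Poly_Mapping.keys a \<subseteq> X"
  shows "monomial_eval a v = (\<Prod>x\<in>X. v x ^ Poly_Mapping.lookup a x)"
  unfolding monomial_eval_def using assms
  by (intro prod.mono_neutral_left) (auto simp: in_keys_iff)

lemma monomial_eval_add: "monomial_eval (a + b) v = monomial_eval a v * monomial_eval b v"
proof -
  let ?X = "Poly_Mapping.keys a \<union> Poly_Mapping.keys b"
  have "Poly_Mapping.keys (a + b) \<subseteq> ?X" by (rule Poly_Mapping.keys_add)
  then show ?thesis
    by (simp add: monomial_eval_superset[of ?X] lookup_add power_add prod.distrib)
qed

lemma mpoly_eval_superset: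
  assumes "finite A" "Poly_Mapping.keys f \<subseteq> A"
  shows "mpoly_eval f v = (\<Sum>a\<in>A. Poly_Mapping.lookup f a * monomial_eval a v)"
  unfolding mpoly_eval_def monomial_eval_def[symmetric] using assms
  by (intro sum.mono_neutral_left) (auto simp: in_keys_iff)

lemma mpoly_eval_zero [simp]: "mpoly_eval 0 v = 0"
  by (simp add: mpoly_eval_def)

lemma mpoly_eval_add: "mpoly_eval (f + g) v = mpoly_eval f v + mpoly_eval g v"
proof -
  let ?A = "Poly_Mapping.keys f \<union> Poly_Mapping.keys g"
  have "Poly_Mapping.keys (f + g) \<subseteq> ?A" by (rule Poly_Mapping.keys_add)
  then show ?thesis
    by (simp add: mpoly_eval_superset[of ?A] lookup_add distrib_right sum.distrib)
qed

lemma mpoly_eval_sum: "mpoly_eval (sum f A) v = (\<Sum>a\<in>A. mpoly_eval (f a) v)"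
  by (induction A rule: infinite_finite_induct) (auto simp: mpoly_eval_add)

lemma mpoly_eval_single: "mpoly_eval (Poly_Mapping.single a c) v = c * monomial_eval a v"
  by (simp add: mpoly_eval_def monomial_eval_def)

lemma mpoly_eval_one: "mpoly_eval 1 v = 1"
  using mpoly_eval_single[of 0 1 v] by (simp add: monomial_eval_def)

lemma mpoly_as_sum:
  fixes f :: "'x real_mpoly"
  shows "f = (\<Sum>a\<in>Poly_Mapping.keys f. Poly_Mapping.single a (Poly_Mapping.lookup f a))"
proof (rule poly_mapping_eqI)
  fix b
  have "(\<Sum>a\<in>Poly_Mapping.keys f. Poly_Mapping.lookup f a when a = b) =
      (\<Sum>a\<in>Poly_Mapping.keys f. if a = b then Poly_Mapping.lookup f a else 0)"
    by (simp add: when_def)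
  then show "Poly_Mapping.lookup f b =
      Poly_Mapping.lookup (\<Sum>a\<in>Poly_Mapping.keys f. Poly_Mapping.single a (Poly_Mapping.lookup f a)) b"
    by (simp add: lookup_sum lookup_single in_keys_iff)
qed

lemma mpoly_eval_mult: "mpoly_eval (f * g) v = mpoly_eval f v * mpoly_eval g v"
proof -
  let ?F = "Poly_Mapping.keys f" and ?G = "Poly_Mapping.keys g"
  let ?s = "\<lambda>f a. Poly_Mapping.single a (Poly_Mapping.lookup f a)"
  have "f * g = (\<Sum>a\<in>?F. ?s f a) * (\<Sum>b\<in>?G. ?s g b)"
    by (rule arg_cong2[where f = "(*)", OF mpoly_as_sum mpoly_as_sum])
  also have "\<dots> = (\<Sum>a\<in>?F. \<Sum>b\<in>?G. ?s f a * ?s g b)"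
    by (rule sum_product)
  finally have "mpoly_eval (f * g) v = (\<Sum>a\<in>?F. \<Sum>b\<in>?G. mpoly_eval (?s f a * ?s g b) v)"
    by (simp only: mpoly_eval_sum)
  also have "\<dots> = (\<Sum>a\<in>?F. \<Sum>b\<in>?G. mpoly_eval (?s f a) v * mpoly_eval (?s g b) v)"
    by (simp add: mult_single mpoly_eval_single monomial_eval_add mult_ac)
  also have "\<dots> = (\<Sum>a\<in>?F. mpoly_eval (?s f a) v) * (\<Sum>b\<in>?G. mpoly_eval (?s g b) v)"
    by (rule sum_product[symmetric])
  also have "\<dots> = mpoly_eval f v * mpoly_eval g v"
    by (simp only: mpoly_eval_sum[symmetric] mpoly_as_sum[symmetric])
  finally show ?thesis .
qed

lemma mpoly_eval_prod: "mpoly_eval (prod f A) v = (\<Prod>a\<in>A. mpoly_eval (f a) v)"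
  by (induction A rule: infinite_finite_induct) (auto simp: mpoly_eval_mult mpoly_eval_one)

lemma mpolys_in_add: "f \<in> mpolys_in X \<Longrightarrow> g \<in> mpolys_in X \<Longrightarrow> f + g \<in> mpolys_in X"
  unfolding mpolys_in_def using Poly_Mapping.keys_add[of f g] by blast

lemma mpolys_in_mult: "f \<in> mpolys_in X \<Longrightarrow> g \<in> mpolys_in X \<Longrightarrow> f * g \<in> mpolys_in X"
proof -
  assume f: "f \<in> mpolys_in X" and g: "g \<in> mpolys_in X"
  have "Poly_Mapping.keys c \<subseteq> X" if c: "c \<in> Poly_Mapping.keys (f * g)" for c
  proof -
    obtain a b where "c = a + b" "a \<in> Poly_Mapping.keys f" "b \<in> Poly_Mapping.keys g"
      using subsetD[OF Poly_Mapping.keys_mult c] by auto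
    then show ?thesis
      using f g Poly_Mapping.keys_add[of a b] unfolding mpolys_in_def by blast
  qed
  then show "f * g \<in> mpolys_in X" by (simp add: mpolys_in_def)
qed

lemma mpolys_in_one: "1 \<in> mpolys_in X"
  by (simp add: mpolys_in_def)

lemma mpolys_in_prod: "(\<And>a. a \<in> A \<Longrightarrow> f a \<in> mpolys_in X) \<Longrightarrow> prod f A \<in> mpolys_in X"
  by (induction A rule: infinite_finite_induct) (auto intro: mpolys_in_mult mpolys_in_one)

definition mpoly_var :: "'x \<Rightarrow> 'x real_mpoly" where
  "mpoly_var x = Poly_Mapping.single (Poly_Mapping.single x 1) 1"

lemma mpoly_eval_var: "mpoly_eval (mpoly_var x) v = v x"
  by (simp add: mpoly_var_def mpoly_eval_single monomial_eval_def)

lemma mpolys_in_var: "x \<in> X \<Longrightarrow> mpoly_var x \<in> mpolys_in X"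
  by (simp add: mpolys_in_def mpoly_var_def)

subsection \<open>Positive rational functions\<close>

text \<open>Positivity of numerator and denominator on the positive orthant gives closure under
  sums, products and quotients without any bookkeeping of denominators; nothing is said about
  \<open>F\<close> elsewhere.\<close>

definition positive_rational :: "'x set \<Rightarrow> (('x \<Rightarrow> real) \<Rightarrow> real) \<Rightarrow> bool" where
  "positive_rational X F \<longleftrightarrow> (\<exists>f\<in>mpolys_in X. \<exists>g\<in>mpolys_in X.
     \<forall>v. (\<forall>x\<in>X. v x > 0) \<longrightarrow>
       mpoly_eval f v > 0 \<and> mpoly_eval g v > 0 \<and> F v = mpoly_eval f v / mpoly_eval g v)"

lemma positive_rational_pos:
  "positive_rational X F \<Longrightarrow> (\<And>x. x \<in> X \<Longrightarrow> v x > 0) \<Longrightarrow> F v > 0"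
  unfolding positive_rational_def by (metis divide_pos_pos)

lemma positive_rational_var: "x \<in> X \<Longrightarrow> positive_rational X (\<lambda>v. v x)"
  unfolding positive_rational_def
  by (intro bexI[of _ "mpoly_var x"] bexI[of _ 1])
    (auto simp: mpoly_eval_var mpoly_eval_one intro: mpolys_in_var mpolys_in_one)

lemma positive_rational_add:
  assumes "positive_rational X F" "positive_rational X G"
  shows "positive_rational X (\<lambda>v. F v + G v)"
proof -
  obtain f f' g g' where m: "f \<in> mpolys_in X" "f' \<in> mpolys_in X" "g \<in> mpolys_in X" "g' \<in> mpolys_in X"
    and F: "\<And>v. (\<forall>x\<in>X. v x > 0) \<Longrightarrow>
      mpoly_eval f v > 0 \<and> mpoly_eval f' v > 0 \<and> F v = mpoly_eval f v / mpoly_eval f' v"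
    and G: "\<And>v. (\<forall>x\<in>X. v x > 0) \<Longrightarrow>
      mpoly_eval g v > 0 \<and> mpoly_eval g' v > 0 \<and> G v = mpoly_eval g v / mpoly_eval g' v"
    using assms unfolding positive_rational_def by metis
  show ?thesis
    unfolding positive_rational_def
  proof (intro bexI allI impI)
    fix v :: "'a \<Rightarrow> real" assume v: "\<forall>x\<in>X. v x > 0"
    show "mpoly_eval (f * g' + g * f') v > 0 \<and> mpoly_eval (f' * g') v > 0 \<and>
        F v + G v = mpoly_eval (f * g' + g * f') v / mpoly_eval (f' * g') v"
      using F[OF v] G[OF v]
      by (auto simp: mpoly_eval_add mpoly_eval_mult add_frac_eq intro!: add_pos_pos)
  qed (use m in \<open>auto intro: mpolys_in_add mpolys_in_mult\<close>)
qed

lemma positive_rational_mult: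
  assumes "positive_rational X F" "positive_rational X G"
  shows "positive_rational X (\<lambda>v. F v * G v)"
proof -
  obtain f f' g g' where m: "f \<in> mpolys_in X" "f' \<in> mpolys_in X" "g \<in> mpolys_in X" "g' \<in> mpolys_in X"
    and F: "\<And>v. (\<forall>x\<in>X. v x > 0) \<Longrightarrow>
      mpoly_eval f v > 0 \<and> mpoly_eval f' v > 0 \<and> F v = mpoly_eval f v / mpoly_eval f' v"
    and G: "\<And>v. (\<forall>x\<in>X. v x > 0) \<Longrightarrow>
      mpoly_eval g v > 0 \<and> mpoly_eval g' v > 0 \<and> G v = mpoly_eval g v / mpoly_eval g' v"
    using assms unfolding positive_rational_def by metis
  show ?thesis
    unfolding positive_rational_def
  proof (intro bexI allI impI)
    fix v :: "'a \<Rightarrow> real" assume v: "\<forall>x\<in>X. v x > 0"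
    show "mpoly_eval (f * g) v > 0 \<and> mpoly_eval (f' * g') v > 0 \<and>
        F v * G v = mpoly_eval (f * g) v / mpoly_eval (f' * g') v"
      using F[OF v] G[OF v] by (auto simp: mpoly_eval_mult)
  qed (use m in \<open>auto intro: mpolys_in_mult\<close>)
qed

lemma positive_rational_inverse:
  assumes "positive_rational X F"
  shows "positive_rational X (\<lambda>v. inverse (F v))"
proof -
  obtain f f' where m: "f \<in> mpolys_in X" "f' \<in> mpolys_in X"
    and F: "\<And>v. (\<forall>x\<in>X. v x > 0) \<Longrightarrow>
      mpoly_eval f v > 0 \<and> mpoly_eval f' v > 0 \<and> F v = mpoly_eval f v / mpoly_eval f' v"
    using assms unfolding positive_rational_def by metis
  show ?thesis
    unfolding positive_rational_def
    by (rule bexI[OF _ m(2)], rule bexI[OF _ m(1)]) (use F in auto)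
qed

lemma positive_rational_divide:
  "positive_rational X F \<Longrightarrow> positive_rational X G \<Longrightarrow> positive_rational X (\<lambda>v. F v / G v)"
  unfolding divide_inverse by (intro positive_rational_mult positive_rational_inverse)

lemma positive_rational_sum:
  assumes "finite A" "A \<noteq> {}" "\<And>a. a \<in> A \<Longrightarrow> positive_rational X (F a)"
  shows "positive_rational X (\<lambda>v. \<Sum>a\<in>A. F a v)"
  using assms by (induction A rule: finite_ne_induct) (auto intro: positive_rational_add)

lemma positive_rational_cong:
  assumes "positive_rational X F" "\<And>v. (\<forall>x\<in>X. v x > 0) \<Longrightarrow> F v = G v"
  shows "positive_rational X G"
  using assms unfolding positive_rational_def by metis

subsection \<open>Polynomials along a monomial curve\<close>

definition curve_poly :: "'x real_mpoly \<Rightarrow> ('x \<Rightarrow> real) \<Rightarrow> ('x \<Rightarrow> nat) \<Rightarrow> real poly" where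
  "curve_poly f c d = (\<Sum>a\<in>Poly_Mapping.keys f. monom (Poly_Mapping.lookup f a * monomial_eval a c)
     (\<Sum>x\<in>Poly_Mapping.keys a. Poly_Mapping.lookup a x * d x))"

lemma poly_curve_poly: "poly (curve_poly f c d) t = mpoly_eval f (\<lambda>x. c x * t ^ d x)"
  unfolding curve_poly_def mpoly_eval_def monomial_eval_def
  by (auto simp: poly_sum poly_monom power_mult_distrib prod.distrib power_sum
      power_mult[symmetric] mult_ac intro!: sum.cong prod.cong)

text \<open>Substituting powers \<open>T ^ w x\<close> with weights \<open>w x = s ^ idx x\<close> that separate the monomials
  of \<open>h\<close>, no two terms cancel.\<close>

lemma mpoly_nonzero_at_positive_naturals:
  assumes h: "h \<in> mpolys_in X" "h \<noteq> 0" and X: "finite X"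
  shows "\<exists>c :: 'x \<Rightarrow> nat. (\<forall>x. c x > 0) \<and> mpoly_eval h (\<lambda>x. real (c x)) \<noteq> 0"
proof -
  obtain idx :: "'x \<Rightarrow> nat" where idx: "inj_on idx X"
    using finite_imp_inj_to_nat_seg[OF X] by blast
  define H where "H = Poly_Mapping.keys h"
  have HX: "Poly_Mapping.keys a \<subseteq> X" if "a \<in> H" for a
    using h(1) that by (auto simp: mpolys_in_def H_def)
  \<comment> \<open>The exponent of \<open>T\<close> coming from the monomial \<open>a\<close>, as a
    polynomial in the still unknown base \<open>s\<close>; since \<open>idx\<close> is injective,
    distinct monomials give distinct polynomials.\<close>
  define q :: "('x \<Rightarrow>\<^sub>0 nat) \<Rightarrow> real poly" where
    "q a = (\<Sum>x\<in>X. monom (real (Poly_Mapping.lookup a x)) (idx x))" for a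
  have q: "poly (q a) (real s) = real (\<Sum>x\<in>Poly_Mapping.keys a. Poly_Mapping.lookup a x * s ^ idx x)"
    if "a \<in> H" for a s
  proof -
    have "(\<Sum>x\<in>Poly_Mapping.keys a. Poly_Mapping.lookup a x * s ^ idx x) =
        (\<Sum>x\<in>X. Poly_Mapping.lookup a x * s ^ idx x)"
      using HX[OF that] X by (intro sum.mono_neutral_left) (auto simp: in_keys_iff)
    then show ?thesis by (simp add: q_def poly_sum poly_monom)
  qed
  have coeff_q: "coeff (q a) (idx x) = real (Poly_Mapping.lookup a x)" if "x \<in> X" for a x
  proof -
    have "coeff (q a) (idx x) = (\<Sum>y\<in>X. if y = x then real (Poly_Mapping.lookup a y) else 0)"
      unfolding q_def coeff_sum coeff_monom
      by (intro sum.cong refl if_cong) (use idx that in \<open>auto dest: inj_onD\<close>)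
    then show ?thesis using that X by simp
  qed
  have q_inj: "a = b" if "a \<in> H" "b \<in> H" "q a = q b" for a b
  proof (rule poly_mapping_eqI)
    fix x
    show "Poly_Mapping.lookup a x = Poly_Mapping.lookup b x"
    proof (cases "x \<in> X")
      case True then show ?thesis using coeff_q[of x] that(3) by (metis of_nat_eq_iff)
    next
      case False
      then have "x \<notin> Poly_Mapping.keys a" "x \<notin> Poly_Mapping.keys b" using HX that by auto
      then show ?thesis by (simp add: in_keys_iff)
    qed
  qed
  \<comment> \<open>A base \<open>s\<close> that is not a root of this product separates all
    exponents at once.\<close>
  define r where "r = (\<Prod>(a, b)\<in>{(a, b) \<in> H \<times> H. a \<noteq> b}. q a - q b)"
  have "finite H" by (simp add: H_def)
  then have fin: "finite {(a, b) \<in> H \<times> H. a \<noteq> b}"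
    by (rule_tac finite_subset[of _ "H \<times> H"]) auto
  have "r \<noteq> 0" unfolding r_def using q_inj fin by auto
  then have "finite {s. poly r s = 0}" by (rule poly_roots_finite)
  then have "finite (real -` {s. poly r s = 0})" by (rule finite_vimageI) (simp add: inj_def)
  then obtain s where s: "poly r (real s) \<noteq> 0"
    using ex_new_if_finite[OF infinite_UNIV_nat] by auto
  define W where "W a = (\<Sum>x\<in>Poly_Mapping.keys a. Poly_Mapping.lookup a x * s ^ idx x)" for a
  have W: "W a \<noteq> W b" if "a \<in> H" "b \<in> H" "a \<noteq> b" for a b
  proof
    assume "W a = W b"
    then have "poly (q a - q b) (real s) = 0"
      using q[OF that(1), of s] q[OF that(2), of s] unfolding W_def[symmetric] by simp
    moreover have "(a, b) \<in> {(a, b) \<in> H \<times> H. a \<noteq> b}" using that by simp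
    ultimately have "poly r (real s) = 0"
      unfolding r_def poly_prod using fin by (intro prod_zero) auto
    with s show False by contradiction
  qed
  define p where "p = curve_poly h (\<lambda>_. 1) (\<lambda>x. s ^ idx x)"
  obtain a where a: "a \<in> H" using h(2) keys_eq_empty[of h] unfolding H_def by blast
  have "coeff p (W a) = (\<Sum>b\<in>H. if b = a then Poly_Mapping.lookup h b else 0)"
    unfolding p_def curve_poly_def coeff_sum coeff_monom W_def[symmetric] H_def[symmetric]
    by (intro sum.cong refl) (use W a in \<open>auto simp: monomial_eval_def\<close>)
  also have "\<dots> \<noteq> 0" using a \<open>finite H\<close> by (simp add: H_def in_keys_iff)
  finally have "p \<noteq> 0" by auto
  then have "finite {t. poly p t = 0}" by (rule poly_roots_finite)
  then have "finite (real -` {t. poly p t = 0})" by (rule finite_vimageI) (simp add: inj_def)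
  \<comment> \<open>Excluding 0 makes all coordinates positive.\<close>
  then obtain T where T: "T \<notin> insert 0 (real -` {t. poly p t = 0})"
    using ex_new_if_finite[OF infinite_UNIV_nat] by (meson finite_insert)
  show ?thesis
  proof (intro exI conjI allI)
    show "mpoly_eval h (\<lambda>x. real (T ^ (s ^ idx x))) \<noteq> 0"
      using T by (simp add: p_def poly_curve_poly)
  qed (use T in auto)
qed

text \<open>The order of growth is the difference of the two degrees, an integer, so nothing lies
  strictly between bounded and linear.\<close>

lemma rational_function_growth:
  fixes p q :: "real poly"
  assumes "q \<noteq> 0"
  shows "(\<exists>K. \<forall>\<^sub>F t in sequentially. \<bar>poly p (real t) / poly q (real t)\<bar> \<le> K) \<or>
    (\<exists>k>0. \<forall>\<^sub>F t in sequentially. \<bar>poly p (real t) / poly q (real t)\<bar> \<ge> k * real t)"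
proof -
  have inf: "filterlim real at_infinity sequentially"
    using filterlim_real_sequentially filterlim_at_top_imp_at_infinity by blast
  have lim: "(\<lambda>t. poly p (real t) / real t ^ degree p) \<longlonglongrightarrow> lead_coeff p" for p :: "real poly"
    by (rule filterlim_compose[OF poly_divide_tendsto_aux inf])
  define r where "r t = (poly p (real t) / real t ^ degree p) / (poly q (real t) / real t ^ degree q)" for t
  have r: "r \<longlonglongrightarrow> lead_coeff p / lead_coeff q"
    unfolding r_def by (intro tendsto_divide lim) (use assms in auto)
  show ?thesis
  proof (cases "degree p \<le> degree q")
    case True
    let ?K = "\<bar>lead_coeff p / lead_coeff q\<bar> + 1"
    have "\<forall>\<^sub>F t in sequentially. \<bar>r t\<bar> < ?K"
      by (rule order_tendstoD[OF tendsto_rabs[OF r]]) simp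
    then have "\<forall>\<^sub>F t in sequentially. \<bar>poly p (real t) / poly q (real t)\<bar> \<le> ?K"
      using eventually_gt_at_top[of 0]
    proof eventually_elim
      case (elim t)
      obtain d where d: "degree q = degree p + d" using True le_Suc_ex by blast
      have "poly p (real t) / poly q (real t) * real t ^ d = r t"
        using elim(2) by (simp add: r_def d power_add field_simps)
      then have "\<bar>poly p (real t) / poly q (real t)\<bar> * real t ^ d \<le> ?K"
        using elim(1) by (metis abs_mult abs_of_nonneg less_imp_le of_nat_0_le_iff zero_le_power)
      moreover have "1 \<le> real t ^ d" using elim(2) by simp
      from mult_left_mono[OF this abs_ge_zero[of "poly p (real t) / poly q (real t)"]]
      have "\<bar>poly p (real t) / poly q (real t)\<bar>
          \<le> \<bar>poly p (real t) / poly q (real t)\<bar> * real t ^ d" by simp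
      ultimately show ?case by (rule order_trans[rotated])
    qed
    then show ?thesis by blast
  next
    case False
    then have p0: "p \<noteq> 0" by auto
    let ?k = "\<bar>lead_coeff p / lead_coeff q\<bar> / 2"
    have k: "?k > 0" using p0 assms by simp
    have "\<forall>\<^sub>F t in sequentially. \<bar>r t\<bar> > ?k"
      by (rule order_tendstoD[OF tendsto_rabs[OF r]]) (use k in simp)
    then have "\<forall>\<^sub>F t in sequentially. \<bar>poly p (real t) / poly q (real t)\<bar> \<ge> ?k * real t"
      using eventually_gt_at_top[of 0]
    proof eventually_elim
      case (elim t)
      obtain d where d: "degree p = degree q + Suc d"
        using False by (metis add_Suc_right less_imp_Suc_add not_le)
      have "poly p (real t) / poly q (real t) = r t * real t ^ Suc d"
        using elim(2) by (simp add: r_def d power_add field_simps)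
      then have "\<bar>poly p (real t) / poly q (real t)\<bar> = \<bar>r t\<bar> * real t ^ Suc d"
        by (simp add: abs_mult)
      moreover have "real t * 1 \<le> real t * real t ^ d"
        using elim(2) by (intro mult_left_mono) simp_all
      then have "?k * real t \<le> \<bar>r t\<bar> * real t ^ Suc d"
        using elim(1) by (intro mult_mono) simp_all
      ultimately show ?case by simp
    qed
    with k show ?thesis by blast
  qed
qed

section \<open>A rational solution of the likelihood equations\<close>

text \<open>The vertex type is kept: \<open>a\<close> becomes isolated, and its margin equation
  reads 0 = 0.\<close>

definition delete_vertex :: "('v \<Rightarrow> 'v \<Rightarrow> bool) \<Rightarrow> 'v \<Rightarrow> 'v \<Rightarrow> 'v \<Rightarrow> bool" where
  "delete_vertex E a u v \<longleftrightarrow> E u v \<and> u \<noteq> a \<and> v \<noteq> a"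

text \<open>Each position of the cycle has an edge, so the isolated vertex \<open>a\<close> does not
  occur on it.\<close>

lemma (in bipartite_adjacency) cycle_with_chords_delete_vertex:
  assumes c: "cycle_with_chords (delete_vertex E a) v L C" and L: "2 \<le> L"
  shows "cycle_with_chords E v L C"
proof -
  have "v i \<noteq> a" if i: "i < L" for i
  proof (cases "Suc i < L")
    case True
    then have "delete_vertex E a (v i) (v (Suc i))"
      using c unfolding cycle_with_chords_def by blast
    then show ?thesis by (simp add: delete_vertex_def)
  next
    case False
    with i L obtain k where k: "i = Suc k" by (cases i) auto
    then have "delete_vertex E a (v k) (v i)"
      using c i unfolding cycle_with_chords_def by blast
    then show ?thesis by (simp add: delete_vertex_def)
  qed
  then have "delete_vertex E a (v i) (v j) \<longleftrightarrow> E (v i) (v j)" if "i < j" "j < L" for i j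
    using that by (simp add: delete_vertex_def)
  then show ?thesis using c unfolding cycle_with_chords_def by blast
qed

lemma (in bipartite_adjacency) bipartite_adjacency_delete_vertex:
  "bipartite_adjacency (delete_vertex E a) side"
proof
  show "delete_vertex E a v u" if "delete_vertex E a u v" for u v
    using that sym[of u v] by (simp add: delete_vertex_def)
  show "side u \<noteq> side v" if "delete_vertex E a u v" for u v
    using that side[of u v] by (simp add: delete_vertex_def)
qed

lemma (in bipartite_adjacency) distance_hereditary_delete_vertex:
  "distance_hereditary E \<Longrightarrow> distance_hereditary (delete_vertex E a)"
  unfolding distance_hereditary_def
proof (intro conjI allI impI notI; elim conjE)
  fix v :: "nat \<Rightarrow> 'v" and L :: nat
  assume "\<forall>v L. 6 \<le> L \<longrightarrow> \<not> cycle_with_chords E v L {}" "6 \<le> L"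
    "cycle_with_chords (delete_vertex E a) v L {}"
  then show False using cycle_with_chords_delete_vertex[of a v L "{}"] by simp
next
  fix v :: "nat \<Rightarrow> 'v"
  assume "\<forall>v. \<not> cycle_with_chords E v 6 {(0, 3)}"
    "cycle_with_chords (delete_vertex E a) v 6 {(0, 3)}"
  then show False using cycle_with_chords_delete_vertex[of a v 6 "{(0, 3)}"] by simp
qed

text \<open>The vector \<open>y w\<close> gives the vertex parameters of the model, \<open>c\<close> the counts, which range
  over positive rational functions so that twins can be merged in the induction.\<close>

definition margin_solution ::
    "'x set \<Rightarrow> ('v \<Rightarrow> 'v \<Rightarrow> bool) \<Rightarrow> ('v \<Rightarrow> 'v \<Rightarrow> ('x \<Rightarrow> real) \<Rightarrow> real) \<Rightarrow> (('x \<Rightarrow> real) \<Rightarrow> 'v \<Rightarrow> real) \<Rightarrow> bool"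
  where
  "margin_solution X E c y \<longleftrightarrow>
     (\<forall>w. (\<forall>x\<in>X. w x > 0) \<longrightarrow> (\<forall>u. y w u > 0) \<and>
       (\<forall>u. (\<Sum>v\<in>{v. E u v}. y w u * y w v) = (\<Sum>v\<in>{v. E u v}. c u v w))) \<and>
     (\<forall>u v. E u v \<longrightarrow> positive_rational X (\<lambda>w. y w u * y w v))"

text \<open>The margin at \<open>a\<close> consists of the single edge to \<open>b\<close>, so the
  product on this edge must equal the count \<open>c a b\<close>. These terms cancel in the equation
  at \<open>b\<close>, and what is left is the system of the smaller graph.\<close>

lemma margin_solution_pendant:
  fixes c :: "'v \<Rightarrow> 'v \<Rightarrow> ('x \<Rightarrow> real) \<Rightarrow> real"
  assumes "bipartite_adjacency E side"
    and fin: "finite {(u, v). E u v}"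
    and c: "\<And>u v. E u v \<Longrightarrow> positive_rational X (c u v)" "\<And>u v. E u v \<Longrightarrow> c u v = c v u"
    and ab: "E a b" "\<And>z. E a z \<Longrightarrow> z = b"
    and sol: "margin_solution X (delete_vertex E a) c y'"
  shows "\<exists>y. margin_solution X E c y"
proof -
  interpret bipartite_adjacency E side by fact
  have sym': "E u v \<longleftrightarrow> E v u" for u v using sym by blast
  have ne: "a \<noteq> b" using side[OF ab(1)] by auto
  have fin': "finite {v. E u v}" for u
    by (rule finite_subset[OF _ finite_imageI[OF fin, of snd]]) force
  define y where "y w u = (if u = a then c a b w / y' w b else y' w u)" for w u
  have pos: "y' w u > 0" if "\<forall>x\<in>X. w x > 0" for w u
    using sol that by (simp add: margin_solution_def)
  have cpos: "c a b w > 0" if "\<forall>x\<in>X. w x > 0" for w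
    using positive_rational_pos[OF c(1)[OF ab(1)]] that by auto
  have yab: "y w a * y w b = c a b w" if "\<forall>x\<in>X. w x > 0" for w
    using pos[OF that, of b] ne by (simp add: y_def)
  have Ea: "{v. E a v} = {b}" using ab by blast
  have "(\<Sum>v\<in>{v. E u v}. y w u * y w v) = (\<Sum>v\<in>{v. E u v}. c u v w)"
    if w: "\<forall>x\<in>X. w x > 0" for w u
  proof -
    let ?N = "{v. delete_vertex E a u v}"
    have old: "(\<Sum>v\<in>?N. y w u * y w v) = (\<Sum>v\<in>?N. c u v w)" if "u \<noteq> a"
    proof -
      have "(\<Sum>v\<in>?N. y w u * y w v) = (\<Sum>v\<in>?N. y' w u * y' w v)"
        using that by (intro sum.cong) (auto simp: y_def delete_vertex_def)
      then show ?thesis using sol w by (simp add: margin_solution_def)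
    qed
    consider "u = a" | "u = b" | "u \<noteq> a" "u \<noteq> b" by blast
    then show ?thesis
    proof cases
      case 1 then show ?thesis using yab[OF w] Ea by simp
    next
      case 2
      have N: "{v. E u v} = insert a ?N" "a \<notin> ?N"
        using 2 ab(1) ne sym' by (auto simp: delete_vertex_def)
      have "finite ?N" by (rule finite_subset[OF _ fin'[of u]]) (auto simp: delete_vertex_def)
      then show ?thesis
        using N old 2 ne yab[OF w] c(2)[OF ab(1)] by (simp add: mult.commute)
    next
      case 3
      then have "\<not> E u a" using ab(2)[of u] sym'[of a u] by blast
      then have "{v. E u v} = ?N" using 3 by (auto simp: delete_vertex_def)
      then show ?thesis using old 3 by simp
    qed
  qed
  moreover have "y w u > 0" if "\<forall>x\<in>X. w x > 0" for w u
    using pos[OF that] cpos[OF that] by (auto simp: y_def)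
  moreover have "positive_rational X (\<lambda>w. y w u * y w v)" if "E u v" for u v
  proof -
    note Euv = that
    consider "u = a" "v = b" | "u = b" "v = a" | "delete_vertex E a u v"
      using ab(2)[of v] ab(2)[of u] Euv sym[OF Euv] unfolding delete_vertex_def by blast
    then show ?thesis
    proof cases
      case 1
      then show ?thesis
        using positive_rational_cong[OF c(1)[OF ab(1)], of "\<lambda>w. y w u * y w v"] yab by simp
    next
      case 2
      then show ?thesis
        using positive_rational_cong[OF c(1)[OF ab(1)], of "\<lambda>w. y w u * y w v"] yab
        by (simp add: mult.commute)
    next
      case 3
      then show ?thesis
        using sol by (auto simp: margin_solution_def y_def delete_vertex_def)
    qed
  qed
  ultimately have "margin_solution X E c y" by (simp add: margin_solution_def)
  then show ?thesis by blast
qed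

text \<open>In the merged graph \<open>b\<close> carries the counts of both twins. Splitting its
  parameter in the ratio of the two margins preserves the sum \<open>y w a + y w b\<close>, so the
  equations at the common neighbours are unaffected, and each twin obtains its share of the merged
  margin.\<close>

lemma margin_solution_twins:
  fixes c :: "'v \<Rightarrow> 'v \<Rightarrow> ('x \<Rightarrow> real) \<Rightarrow> real"
  assumes "bipartite_adjacency E side"
    and fin: "finite {(u, v). E u v}"
    and c: "\<And>u v. E u v \<Longrightarrow> positive_rational X (c u v)" "\<And>u v. E u v \<Longrightarrow> c u v = c v u"
    and tw: "a \<noteq> b" "E a z" "\<And>z. E a z \<longleftrightarrow> E b z"
    and sol: "margin_solution X (delete_vertex E a)
      (\<lambda>u v w. if u = b then c b v w + c a v w else if v = b then c u b w + c u a w else c u v w) y'"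
      (is "margin_solution X _ ?c' y'")
  shows "\<exists>y. margin_solution X E c y"
proof -
  interpret bipartite_adjacency E side by fact
  have sym': "E u v \<longleftrightarrow> E v u" for u v using sym by blast
  have irr: "\<not> E u u" for u using side by blast
  have nab: "\<not> E a b" "\<not> E b a" using irr tw(3) by blast+
  have fin': "finite {v. E u v}" for u
    by (rule finite_subset[OF _ finite_imageI[OF fin, of snd]]) force
  define Ca where "Ca w = (\<Sum>v\<in>{v. E a v}. c a v w)" for w
  define Cb where "Cb w = (\<Sum>v\<in>{v. E b v}. c b v w)" for w
  have rat: "positive_rational X Ca" "positive_rational X Cb"
    unfolding Ca_def Cb_def using fin' tw c(1)
    by (intro positive_rational_sum; auto)+
  have Cpos: "Ca w > 0" "Cb w > 0" if "\<forall>x\<in>X. w x > 0" for w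
    using rat[THEN positive_rational_pos] that by auto
  define y where "y w u = (if u = a then y' w b * (Ca w / (Ca w + Cb w))
     else if u = b then y' w b * (Cb w / (Ca w + Cb w)) else y' w u)" for w u
  have pos: "y' w u > 0" if "\<forall>x\<in>X. w x > 0" for w u
    using sol that by (simp add: margin_solution_def)
  have yab: "y w a + y w b = y' w b" if "\<forall>x\<in>X. w x > 0" for w
  proof -
    have "y w a + y w b = y' w b * ((Ca w + Cb w) / (Ca w + Cb w))"
      unfolding add_divide_distrib distrib_left using tw(1) by (simp add: y_def)
    then show ?thesis using Cpos[OF that] by simp
  qed
  have old: "(\<Sum>v\<in>{v. delete_vertex E a u v}. y' w u * y' w v) =
      (\<Sum>v\<in>{v. delete_vertex E a u v}. ?c' u v w)" if "\<forall>x\<in>X. w x > 0" for w u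
    using sol that by (simp add: margin_solution_def)
  have Nb: "{v. delete_vertex E a b v} = {v. E b v}" "{v. E a v} = {v. E b v}"
    using tw(1) tw(3) nab by (auto simp: delete_vertex_def)
  have merged: "(\<Sum>v\<in>{v. E b v}. y' w b * y' w v) = Ca w + Cb w" if "\<forall>x\<in>X. w x > 0" for w
    using old[OF that, of b] by (simp add: Nb Ca_def Cb_def sum.distrib)
  have "(\<Sum>v\<in>{v. E u v}. y w u * y w v) = (\<Sum>v\<in>{v. E u v}. c u v w)"
    if w: "\<forall>x\<in>X. w x > 0" for w u
  proof -
    note Cp = Cpos[OF w]
    \<comment> \<open>A share \<open>t / (Ca w + Cb w)\<close> of the parameter at \<open>b\<close>
      produces a margin \<open>t\<close>, because the whole parameter produces
      \<open>Ca w + Cb w\<close>.\<close>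
    have twin: "(\<Sum>v\<in>{v. E b v}. (y' w b * (t / (Ca w + Cb w))) * y w v) = t" for t
    proof -
      have "(\<Sum>v\<in>{v. E b v}. (y' w b * (t / (Ca w + Cb w))) * y w v) =
          (\<Sum>v\<in>{v. E b v}. (t / (Ca w + Cb w)) * (y' w b * y' w v))"
        using nab irr tw(3) by (intro sum.cong) (auto simp: y_def)
      also have "\<dots> = (t / (Ca w + Cb w)) * (Ca w + Cb w)"
        unfolding merged[OF w, symmetric] by (rule sum_distrib_left[symmetric])
      finally show ?thesis using Cp by simp
    qed
    consider "u = a" | "u = b" | "u \<noteq> a" "u \<noteq> b" "E u a" | "u \<noteq> a" "u \<noteq> b" "\<not> E u a" by blast
    then show ?thesis
    proof cases
      case 1
      have "y w a = y' w b * (Ca w / (Ca w + Cb w))" by (simp add: y_def)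
      then have "(\<Sum>v\<in>{v. E b v}. y w a * y w v) = Ca w" using twin[of "Ca w"] by (simp only:)
      then show ?thesis unfolding 1 Ca_def Nb(2) .
    next
      case 2
      have "y w b = y' w b * (Cb w / (Ca w + Cb w))" using tw(1) by (simp add: y_def)
      then have "(\<Sum>v\<in>{v. E b v}. y w b * y w v) = Cb w" using twin[of "Cb w"] by (simp only:)
      then show ?thesis unfolding 2 Cb_def .
    next
      case 3
      let ?R = "{v. E u v \<and> v \<noteq> a \<and> v \<noteq> b}"
      have ub: "E u b" using 3 tw(3) sym' by blast
      have N: "{v. E u v} = insert a (insert b ?R)" "{v. delete_vertex E a u v} = insert b ?R"
        using 3 tw(1) ub by (auto simp: delete_vertex_def)
      have fR: "finite ?R" by (rule finite_subset[OF _ fin'[of u]]) auto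
      have "(\<Sum>v\<in>{v. E u v}. y w u * y w v) = y w u * (y w a + y w b) + (\<Sum>v\<in>?R. y w u * y w v)"
        unfolding N using fR tw(1) by (simp add: distrib_left)
      also have "\<dots> = y' w u * y' w b + (\<Sum>v\<in>?R. y' w u * y' w v)"
        unfolding yab[OF w] using 3 by (simp add: y_def)
      also have "\<dots> = (\<Sum>v\<in>{v. delete_vertex E a u v}. y' w u * y' w v)"
        unfolding N using fR by simp
      also have "\<dots> = (\<Sum>v\<in>insert b ?R. ?c' u v w)"
        using old[OF w, of u] unfolding N .
      also have "\<dots> = c u a w + (c u b w + (\<Sum>v\<in>?R. c u v w))"
        using fR 3 by simp
      also have "\<dots> = (\<Sum>v\<in>{v. E u v}. c u v w)"
        unfolding N using fR tw(1) by simp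
      finally show ?thesis .
    next
      case 4
      have "\<not> E u b" using 4 tw(3) sym' by blast
      then have N: "{v. delete_vertex E a u v} = {v. E u v}" "\<And>v. E u v \<Longrightarrow> v \<noteq> a \<and> v \<noteq> b"
        using 4 by (auto simp: delete_vertex_def)
      have "(\<Sum>v\<in>{v. E u v}. y w u * y w v) = (\<Sum>v\<in>{v. E u v}. y' w u * y' w v)"
        using 4 N(2) by (intro sum.cong) (auto simp: y_def)
      also have "\<dots> = (\<Sum>v\<in>{v. E u v}. ?c' u v w)" using old[OF w, of u] unfolding N .
      also have "\<dots> = (\<Sum>v\<in>{v. E u v}. c u v w)"
        using 4 N(2) by (intro sum.cong) auto
      finally show ?thesis .
    qed
  qed
  moreover have "y w u > 0" if "\<forall>x\<in>X. w x > 0" for w u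
    using pos[OF that] Cpos[OF that] by (auto simp: y_def)
  moreover have "positive_rational X (\<lambda>w. y w u * y w v)" if "E u v" for u v
  proof -
    \<comment> \<open>On an edge at a twin the product is the merged product times a rational
      share.\<close>
    have split: "positive_rational X (\<lambda>w. y w d * y w v)" if d: "d = a \<or> d = b" "E d v" for d v
    proof -
      have bv: "E b v" "v \<noteq> a" "v \<noteq> b" using d nab irr tw(3) by auto
      then have "positive_rational X (\<lambda>w. y' w b * y' w v)"
        using sol tw(1) unfolding margin_solution_def delete_vertex_def by blast
      then have "positive_rational X (\<lambda>w. (y' w b * y' w v) * (C w / (Ca w + Cb w)))"
        if "positive_rational X C" for C
        by (rule positive_rational_mult)
          (rule positive_rational_divide[OF that positive_rational_add[OF rat]])
      from this[OF rat(1)] this[OF rat(2)] show ?thesis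
        using d(1) bv tw(1) by (auto simp: y_def mult_ac)
    qed
    note Euv = that
    consider "u = a \<or> u = b" | "v = a \<or> v = b" | "delete_vertex E a u v" "u \<noteq> a" "u \<noteq> b" "v \<noteq> a" "v \<noteq> b"
      using Euv unfolding delete_vertex_def by blast
    then show ?thesis
    proof cases
      case 1 then show ?thesis using split Euv by blast
    next
      case 2
      then have "positive_rational X (\<lambda>w. y w v * y w u)"
        using split[of v u] that sym' by blast
      then show ?thesis by (simp add: mult.commute)
    next
      case 3
      then show ?thesis using sol by (auto simp: margin_solution_def y_def)
    qed
  qed
  ultimately have "margin_solution X E c y" by (simp add: margin_solution_def)
  then show ?thesis by blast
qed

text \<open>The induction on the number of edges generalises over \<open>c\<close>, since merging
  twins adds their counts.\<close>

theorem margin_solution_exists: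
  fixes c :: "'v \<Rightarrow> 'v \<Rightarrow> ('x \<Rightarrow> real) \<Rightarrow> real"
  assumes "bipartite_adjacency E side" "distance_hereditary E" "finite {(u, v). E u v}"
    and "\<And>u v. E u v \<Longrightarrow> positive_rational X (c u v)" "\<And>u v. E u v \<Longrightarrow> c u v = c v u"
  shows "\<exists>y. margin_solution X E c y"
  using assms
proof (induction "card {(u, v). E u v}" arbitrary: E c rule: less_induct)
  case less
  interpret bipartite_adjacency E side by fact
  have sym': "E u v \<longleftrightarrow> E v u" for u v using sym by blast
  have small: "finite {(u, v). delete_vertex E a u v}"
      "card {(u, v). delete_vertex E a u v} < card {(u, v). E u v}" if "E a b" for a b
  proof -
    have "{(u, v). delete_vertex E a u v} \<subset> {(u, v). E u v}"
      using that by (auto simp: delete_vertex_def)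
    then show "finite {(u, v). delete_vertex E a u v}"
        "card {(u, v). delete_vertex E a u v} < card {(u, v). E u v}"
      using finite_subset[OF psubset_imp_subset less.prems(3)]
        psubset_card_mono[OF less.prems(3)] by simp_all
  qed
  note IH = less.hyps[OF small(2) bipartite_adjacency_delete_vertex
      distance_hereditary_delete_vertex[OF less.prems(2)] small(1)]
  show ?case
  proof (cases "\<exists>a b. E a b")
    case False
    then have "margin_solution X E c (\<lambda>_ _. 1)" by (simp add: margin_solution_def)
    then show ?thesis by blast
  next
    case True
    then obtain a b where ab: "E a b" by blast
    have "finite {v. \<exists>w. E v w}"
      by (rule finite_subset[OF _ finite_imageI[OF less.prems(3), of fst]]) force
    from pendant_or_twins[OF less.prems(2) this ab] show ?thesis
    proof (elim disjE exE conjE)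
      fix x y assume xy: "E x y" "\<forall>z. E x z \<longrightarrow> z = y"
      have "\<exists>y'. margin_solution X (delete_vertex E x) c y'"
        using less.prems(4,5) by (intro IH[OF xy(1) xy(1)]) (auto simp: delete_vertex_def)
      then obtain y' where y': "margin_solution X (delete_vertex E x) c y'" by blast
      show ?thesis
        by (rule margin_solution_pendant[OF less.prems(1,3) _ _ xy(1) _ y'])
          (use less.prems(4,5) xy(2) in blast)+
    next
      fix x y z assume xy: "x \<noteq> y" "E x z" "\<forall>z. E x z \<longleftrightarrow> E y z"
      let ?c = "\<lambda>u v w. if u = y then c y v w + c x v w
        else if v = y then c u y w + c u x w else c u v w"
      have "\<exists>y'. margin_solution X (delete_vertex E x) ?c y'"
      proof (rule IH[OF xy(2) xy(2)])
        fix u v assume "delete_vertex E x u v"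
        then have uv: "E u v" "E v u" "u \<noteq> x" "v \<noteq> x" using sym' by (auto simp: delete_vertex_def)
        have x: "E x v" if "u = y" using uv xy that by blast
        have x': "E u x" if "v = y" using uv xy that sym' by blast
        \<comment> \<open>At most one endpoint is \<open>y\<close>, so the two special branches of
          \<open>?c\<close> never compete and \<open>?c\<close> is symmetric.\<close>
        have ny: "\<not> (u = y \<and> v = y)" using uv side by blast
        show "positive_rational X (?c u v)"
          using less.prems(4)[OF uv(1)] less.prems(4)[OF x] less.prems(4)[OF x']
          by (cases "u = y"; cases "v = y") (simp_all add: positive_rational_add)
        show "?c u v = ?c v u"
          using less.prems(5)[OF uv(1)] less.prems(5)[OF x] less.prems(5)[OF x'] ny
          by (cases "u = y"; cases "v = y") auto
      qed
      then obtain y' where y': "margin_solution X (delete_vertex E x) ?c y'" by blast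
      show ?thesis
        by (rule margin_solution_twins[OF less.prems(1,3) _ _ xy(1,2) _ y'])
          (use less.prems(4,5) xy(3) in blast)+
    qed
  qed
qed

section \<open>Maximum likelihood and margins\<close>

fun qi_adj :: "(nat \<times> nat) set \<Rightarrow> nat + nat \<Rightarrow> nat + nat \<Rightarrow> bool" where
  "qi_adj S (Inl i) (Inr j) \<longleftrightarrow> (i, j) \<in> S"
| "qi_adj S (Inr j) (Inl i) \<longleftrightarrow> (i, j) \<in> S"
| "qi_adj S _ _ \<longleftrightarrow> False"

fun cell :: "nat + nat \<Rightarrow> nat + nat \<Rightarrow> nat \<times> nat" where
  "cell (Inl i) (Inr j) = (i, j)"
| "cell (Inr j) (Inl i) = (i, j)"
| "cell _ _ = undefined"

lemma cell_commute: "cell u v = cell v u"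
  by (cases u; cases v) auto

lemma cell_in: "qi_adj S u v \<Longrightarrow> cell u v \<in> S"
  by (cases u; cases v) auto

lemma bipartite_adjacency_qi_adj: "bipartite_adjacency (qi_adj S) isl"
proof
  show "qi_adj S v u" if "qi_adj S u v" for u v using that by (cases u; cases v) auto
  show "isl u \<noteq> isl v" if "qi_adj S u v" for u v using that by (cases u; cases v) auto
qed

definition incident :: "nat + nat \<Rightarrow> nat \<times> nat \<Rightarrow> bool" where
  "incident a e \<longleftrightarrow> a = Inl (fst e) \<or> a = Inr (snd e)"

definition margin :: "(nat \<times> nat) set \<Rightarrow> (nat \<times> nat \<Rightarrow> real) \<Rightarrow> nat + nat \<Rightarrow> real" where
  "margin S f a = (\<Sum>b\<in>{b. qi_adj S a b}. f (cell a b))"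

lemma finite_qi_adj: "finite S \<Longrightarrow> finite {(a, b). qi_adj S a b}"
proof -
  assume "finite S"
  have "{(a, b). qi_adj S a b} \<subseteq> (\<lambda>(i, j). (Inl i, Inr j)) ` S \<union> (\<lambda>(i, j). (Inr j, Inl i)) ` S"
  proof clarify
    fix a b assume "qi_adj S a b" "(a, b) \<notin> (\<lambda>(i, j). (Inr j, Inl i)) ` S"
    then show "(a, b) \<in> (\<lambda>(i, j). (Inl i, Inr j)) ` S" by (cases a; cases b) force+
  qed
  then show ?thesis by (rule finite_subset) (use \<open>finite S\<close> in auto)
qed

lemma margin_incident: "finite S \<Longrightarrow> margin S f a = (\<Sum>e\<in>S. of_bool (incident a e) * f e)"
proof -
  assume S: "finite S"
  have "(\<Sum>e\<in>S. of_bool (incident a e) * f e) = (\<Sum>e\<in>{e\<in>S. incident a e}. f e)"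
    using S by (intro sum.mono_neutral_cong_right) auto
  also have "\<dots> = margin S f a"
    unfolding margin_def
    by (rule sum.reindex_bij_witness[where j = "\<lambda>e. if a = Inl (fst e) then Inr (snd e) else Inl (fst e)"
          and i = "cell a"])
      (auto simp: incident_def elim: qi_adj.elims)
  finally show ?thesis by simp
qed

text \<open>Double counting: every cell is counted at its row and at its column. A function on the
  cells that splits into a row term and a column term therefore sees \<open>f\<close> only through
  the margins.\<close>

lemma sum_vertex_potential:
  assumes S: "S \<subseteq> {1..m} \<times> {1..n}"
  shows "(\<Sum>e\<in>S. f e * (\<alpha> (Inl (fst e)) + \<alpha> (Inr (snd e)))) =
    (\<Sum>a\<in>{1..m} <+> {1..n}. \<alpha> a * margin S f a)"
proof -
  let ?V = "{1..m} <+> {1..n}"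
  have fin: "finite S" by (rule finite_subset[OF S]) simp
  have "(\<Sum>a\<in>?V. \<alpha> a * margin S f a) = (\<Sum>a\<in>?V. \<Sum>e\<in>S. \<alpha> a * (of_bool (incident a e) * f e))"
    by (simp add: margin_incident[OF fin] sum_distrib_left)
  also have "\<dots> = (\<Sum>e\<in>S. \<Sum>a\<in>?V. \<alpha> a * (of_bool (incident a e) * f e))"
    by (rule sum.swap)
  also have "\<dots> = (\<Sum>e\<in>S. f e * (\<alpha> (Inl (fst e)) + \<alpha> (Inr (snd e))))"
  proof (rule sum.cong[OF refl])
    fix e assume "e \<in> S"
    then have "{Inl (fst e), Inr (snd e)} \<subseteq> ?V" using S by auto
    then have "(\<Sum>a\<in>?V. \<alpha> a * (of_bool (incident a e) * f e)) =
        (\<Sum>a\<in>{Inl (fst e), Inr (snd e)}. \<alpha> a * (of_bool (incident a e) * f e))"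
      by (intro sum.mono_neutral_right) (auto simp: incident_def)
    then show "(\<Sum>a\<in>?V. \<alpha> a * (of_bool (incident a e) * f e)) =
        f e * (\<alpha> (Inl (fst e)) + \<alpha> (Inr (snd e)))"
      by (simp add: incident_def algebra_simps)
  qed
  finally show ?thesis by simp
qed

lemma qi_model_parameters:
  assumes S: "S \<subseteq> {1..m} \<times> {1..n}" and p: "p \<in> qi_model m n S"
  obtains y where "\<And>a. y a > (0::real)" "\<And>e. e \<in> S \<Longrightarrow> p e = y (Inl (fst e)) * y (Inr (snd e))"
proof -
  from p obtain s t where p: "p = qi_param S (s, t)" "p \<in> open_simplex S"
    by (auto simp: qi_model_def)
  \<comment> \<open>Absolute values leave the products on \<open>S\<close> unchanged, as these are
    positive; the default 1 replaces zero parameters, which occur at no cell of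
    \<open>S\<close>.\<close>
  define y where "y a = (let x = case_sum s t a in if x = 0 then 1 else \<bar>x\<bar>)" for a
  show thesis
  proof (rule that)
    show "y a > 0" for a by (simp add: y_def Let_def)
    fix e assume e: "e \<in> S"
    have "p e > 0" using p(2) e by (simp add: open_simplex_def)
    moreover have pe: "p e = s (fst e) * t (snd e)"
      using e p(1) by (simp add: qi_param_def split_beta)
    ultimately have "0 < s (fst e) * t (snd e)" by simp
    then have "s (fst e) \<noteq> 0" "t (snd e) \<noteq> 0" "p e = \<bar>s (fst e) * t (snd e)\<bar>"
      unfolding pe by (auto simp: abs_of_pos)
    then show "p e = y (Inl (fst e)) * y (Inr (snd e))"
      by (simp add: y_def abs_mult)
  qed
qed

lemma qi_modelI:
  assumes S: "S \<subseteq> {1..m} \<times> {1..n}" and y: "\<And>a. y a > (0::real)"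
    and p: "p \<in> S \<rightarrow>\<^sub>E UNIV" "\<And>e. e \<in> S \<Longrightarrow> p e = y (Inl (fst e)) * y (Inr (snd e))" "(\<Sum>e\<in>S. p e) = 1"
  shows "p \<in> qi_model m n S"
proof -
  let ?s = "restrict (\<lambda>i. y (Inl i)) {1..m}" and ?t = "restrict (\<lambda>j. y (Inr j)) {1..n}"
  have "p = qi_param S (?s, ?t)"
  proof
    fix e
    show "p e = qi_param S (?s, ?t) e"
    proof (cases "e \<in> S")
      case True
      then have "fst e \<in> {1..m}" "snd e \<in> {1..n}" using S by auto
      then show ?thesis using True p(2)[OF True] by (simp add: qi_param_def split_beta)
    next
      case False
      then show ?thesis using PiE_arb[OF p(1) False] by (simp add: qi_param_def)
    qed
  qed
  moreover have "p \<in> open_simplex S"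
    using p y by (simp add: open_simplex_def)
  ultimately show ?thesis unfolding qi_model_def by (intro IntI image_eqI[where x = "(?s, ?t)"]) auto
qed

section \<open>Margins characterise the maximum likelihood estimate\<close>

lemma ln_likelihood:
  "finite I \<Longrightarrow> (\<And>i. i \<in> I \<Longrightarrow> p i > 0) \<Longrightarrow> likelihood I u p = exp (\<Sum>i\<in>I. real (u i) * ln (p i))"
  by (simp add: likelihood_def exp_sum exp_of_nat_mult)

text \<open>Summation of \<open>ln x \<le> x - 1\<close> at \<open>x = q i / p i\<close>, which is
  strict unless \<open>x = 1\<close>.\<close>

lemma Gibbs_strict:
  fixes p q :: "'i \<Rightarrow> real"
  assumes "finite I" and p: "\<And>i. i \<in> I \<Longrightarrow> p i > 0" "(\<Sum>i\<in>I. p i) = 1"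
    and q: "\<And>i. i \<in> I \<Longrightarrow> q i > 0" "(\<Sum>i\<in>I. q i) = 1" and ne: "\<exists>i\<in>I. p i \<noteq> q i"
  shows "(\<Sum>i\<in>I. p i * ln (q i)) < (\<Sum>i\<in>I. p i * ln (p i))"
proof -
  have le: "p i * ln (q i) - p i * ln (p i) \<le> q i - p i" if "i \<in> I" for i
  proof -
    have "p i * ln (q i / p i) \<le> p i * (q i / p i - 1)"
      using p(1)[OF that] q(1)[OF that] by (intro mult_left_mono ln_le_minus_one) auto
    then show ?thesis using p(1)[OF that] q(1)[OF that] by (simp add: ln_div algebra_simps)
  qed
  obtain k where k: "k \<in> I" "p k \<noteq> q k" using ne by blast
  have "ln (q k / p k) \<noteq> q k / p k - 1"
    using ln_eq_minus_one[of "q k / p k"] p(1)[OF k(1)] q(1)[OF k(1)] k(2) by auto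
  then have "ln (q k / p k) < q k / p k - 1"
    using ln_le_minus_one[of "q k / p k"] p(1)[OF k(1)] q(1)[OF k(1)] by fastforce
  then have "p k * ln (q k / p k) < p k * (q k / p k - 1)"
    using p(1)[OF k(1)] by simp
  then have "p k * ln (q k) - p k * ln (p k) < q k - p k"
    using p(1)[OF k(1)] q(1)[OF k(1)] by (simp add: ln_div algebra_simps)
  with k(1) have "(\<Sum>i\<in>I. p i * ln (q i) - p i * ln (p i)) < (\<Sum>i\<in>I. q i - p i)"
    using le by (intro sum_strict_mono_ex1 \<open>finite I\<close>) blast+
  then show ?thesis using p(2) q(2) by (simp add: sum_subtractf)
qed

text \<open>The logarithm of a point of the model is a row term plus a column term, so
  \<open>u\<close> may be replaced by \<open>N\<close> times \<open>p\<close> in the log-likelihood;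
  then \<open>p\<close> is the unique maximiser by the Gibbs inequality.\<close>

lemma mle_of_margins:
  assumes S: "S \<subseteq> {1..m} \<times> {1..n}" and y: "\<And>a. y a > (0::real)"
    and p: "p \<in> S \<rightarrow>\<^sub>E UNIV" "\<And>e. e \<in> S \<Longrightarrow> p e = y (Inl (fst e)) * y (Inr (snd e))" "(\<Sum>e\<in>S. p e) = 1"
    and N: "N > 0" and marg: "\<And>a. margin S (\<lambda>e. real (u e)) a = N * margin S p a"
  shows "{q. is_mle S (qi_model m n S) u q} = {p}"
proof -
  have fin: "finite S" by (rule finite_subset[OF S]) simp
  have pM: "p \<in> qi_model m n S" by (rule qi_modelI[OF S y p])
  have pos: "q e > 0" if "q \<in> qi_model m n S" "e \<in> S" for q e
    using that by (auto simp: qi_model_def open_simplex_def)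
  have sum1: "(\<Sum>e\<in>S. q e) = 1" if "q \<in> qi_model m n S" for q
    using that by (auto simp: qi_model_def open_simplex_def)
  have lin: "(\<Sum>e\<in>S. real (u e) * ln (q e)) = N * (\<Sum>e\<in>S. p e * ln (q e))"
    if q: "q \<in> qi_model m n S" for q
  proof -
    obtain z where z: "\<And>a. z a > 0" "\<And>e. e \<in> S \<Longrightarrow> q e = z (Inl (fst e)) * z (Inr (snd e))"
      using qi_model_parameters[OF S q] by metis
    have ln: "(\<Sum>e\<in>S. f e * ln (q e)) =
        (\<Sum>e\<in>S. f e * (ln (z (Inl (fst e))) + ln (z (Inr (snd e)))))" for f
      using z by (intro sum.cong refl) (simp add: ln_mult_pos)
    show ?thesis
      unfolding ln sum_vertex_potential[OF S, of _ "\<lambda>a. ln (z a)"]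
      by (simp add: marg sum_distrib_left mult_ac)
  qed
  have less: "likelihood S u q < likelihood S u p" if q: "q \<in> qi_model m n S" "q \<noteq> p" for q
  proof -
    have "q \<in> S \<rightarrow>\<^sub>E UNIV" using q(1) by (auto simp: qi_model_def open_simplex_def)
    then have "\<exists>e\<in>S. p e \<noteq> q e" using q(2) PiE_ext[OF p(1), of q] by metis
    with Gibbs_strict[OF fin, of p q] pos[OF pM] pos[OF q(1)] p(3) sum1[OF q(1)]
    have "(\<Sum>e\<in>S. p e * ln (q e)) < (\<Sum>e\<in>S. p e * ln (p e))" by simp
    then have "(\<Sum>e\<in>S. real (u e) * ln (q e)) < (\<Sum>e\<in>S. real (u e) * ln (p e))"
      unfolding lin[OF q(1)] lin[OF pM] using N by simp
    then show ?thesis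
      using ln_likelihood[OF fin] pos[OF pM] pos[OF q(1)] by simp
  qed
  then have "is_mle S (qi_model m n S) u q \<longleftrightarrow> q = p" for q
    unfolding is_mle_def is_arg_max_def using pM by (metis less_asym)
  then show ?thesis by auto
qed

text \<open>Scaling the parameter of the vertex \<open>a\<close> by \<open>exp \<tau>\<close> and
  normalising stays inside the model, so the derivative of the log-likelihood at
  \<open>\<tau> = 0\<close> vanishes; this is the margin equation at \<open>a\<close>.\<close>

lemma margins_of_mle:
  assumes S: "S \<subseteq> {1..m} \<times> {1..n}" and mle: "is_mle S (qi_model m n S) u p"
  shows "margin S (\<lambda>e. real (u e)) a = (\<Sum>e\<in>S. real (u e)) * margin S p a"
proof -
  have fin: "finite S" by (rule finite_subset[OF S]) simp
  have pM: "p \<in> qi_model m n S" using mle by (simp add: is_mle_def is_arg_max_def)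
  have pos: "q e > 0" if "q \<in> qi_model m n S" "e \<in> S" for q e
    using that by (auto simp: qi_model_def open_simplex_def)
  have sum1: "(\<Sum>e\<in>S. p e) = 1"
    using pM by (auto simp: qi_model_def open_simplex_def)
  obtain y where y: "\<And>a. y a > 0" "\<And>e. e \<in> S \<Longrightarrow> p e = y (Inl (fst e)) * y (Inr (snd e))"
    using qi_model_parameters[OF S pM] by metis
  let ?b = "\<lambda>e. of_bool (incident a e) :: real"
  define N U where "N = (\<Sum>e\<in>S. real (u e))" and "U = margin S (\<lambda>e. real (u e)) a"
  define Z where "Z \<tau> = (\<Sum>e\<in>S. p e * exp (\<tau> * ?b e))" for \<tau>
  define q where "q \<tau> = (\<lambda>e\<in>S. p e * exp (\<tau> * ?b e) / Z \<tau>)" for \<tau>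
  have "S \<noteq> {}" using sum1 by auto
  then have Zpos: "Z \<tau> > 0" for \<tau>
    unfolding Z_def using fin pos[OF pM] by (intro sum_pos) auto
  have Z0: "Z 0 = 1" by (simp add: Z_def sum1)
  have qM: "q \<tau> \<in> qi_model m n S" for \<tau>
  proof (rule qi_modelI[OF S])
    \<comment> \<open>The normalising factor is put on the row vertices only, so that each cell is
      divided by \<open>Z \<tau>\<close> exactly once.\<close>
    let ?y = "\<lambda>b. (if b = a then y b * exp \<tau> else y b) / (if isl b then Z \<tau> else 1)"
    show "?y b > 0" for b using y(1)[of a] y(1)[of b] Zpos[of \<tau>] by simp
    show "q \<tau> e = ?y (Inl (fst e)) * ?y (Inr (snd e))" if "e \<in> S" for e
      using y(2)[OF that] that by (auto simp: q_def incident_def)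
    show "(\<Sum>e\<in>S. q \<tau> e) = 1"
      using Zpos[of \<tau>] by (simp add: q_def sum_divide_distrib[symmetric] Z_def[symmetric])
  qed (simp add: q_def)
  have ln_q: "(\<Sum>e\<in>S. real (u e) * ln (q \<tau> e)) = (\<Sum>e\<in>S. real (u e) * ln (p e)) + \<tau> * U - N * ln (Z \<tau>)"
    for \<tau>
  proof -
    have "(\<Sum>e\<in>S. real (u e) * ln (q \<tau> e)) =
        (\<Sum>e\<in>S. real (u e) * ln (p e) + \<tau> * (?b e * real (u e)) - real (u e) * ln (Z \<tau>))"
    proof (rule sum.cong[OF refl])
      fix e assume e: "e \<in> S"
      have ln_qe: "ln (q \<tau> e) = ln (p e) + \<tau> * ?b e - ln (Z \<tau>)"
        using e pos[OF pM e] Zpos[of \<tau>] by (simp add: q_def ln_div ln_mult_pos)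
      show "real (u e) * ln (q \<tau> e) =
          real (u e) * ln (p e) + \<tau> * (?b e * real (u e)) - real (u e) * ln (Z \<tau>)"
        unfolding ln_qe by (simp only: algebra_simps)
    qed
    then show ?thesis
      by (simp add: sum.distrib sum_subtractf sum_distrib_left[symmetric] sum_distrib_right[symmetric]
          U_def margin_incident[OF fin] N_def)
  qed
  \<comment> \<open>The change of the log-likelihood from \<open>p\<close> to
    \<open>q \<tau>\<close>.\<close>
  define G where "G \<tau> = \<tau> * U - N * ln (Z \<tau>)" for \<tau>
  have "G \<tau> \<le> G 0" for \<tau>
  proof -
    have "likelihood S u (q \<tau>) \<le> likelihood S u p"
      using mle qM[of \<tau>] unfolding is_mle_def is_arg_max_def by (meson not_less)
    then have "(\<Sum>e\<in>S. real (u e) * ln (q \<tau> e)) \<le> (\<Sum>e\<in>S. real (u e) * ln (p e))"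
      using ln_likelihood[OF fin] pos[OF pM] pos[OF qM] by simp
    then show ?thesis by (simp add: ln_q G_def Z0)
  qed
  moreover have "(Z has_real_derivative margin S p a) (at 0)"
    unfolding Z_def margin_incident[OF fin]
    by (rule derivative_eq_intros refl | simp add: mult.commute)+
  then have "(G has_real_derivative (U - N * margin S p a)) (at 0)"
    unfolding G_def
    by (auto intro!: derivative_eq_intros simp: Z0)
  ultimately have "U - N * margin S p a = 0"
    using DERIV_local_max[of G "U - N * margin S p a" 0 1] by auto
  then show ?thesis by (simp add: U_def N_def)
qed

section \<open>Doubly chordal bipartite graphs\<close>

lemma (in bipartite_adjacency) side_along_cycle:
  assumes "cycle_with_chords E v L C" "i < L"
  shows "side (v i) \<longleftrightarrow> (side (v 0) \<longleftrightarrow> even i)"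
  using assms(2)
proof (induction i)
  case (Suc i)
  then have "E (v i) (v (Suc i))"
    using assms(1) by (simp add: cycle_with_chords_def)
  then show ?case using Suc side[of "v i" "v (Suc i)"] by auto
qed simp

text \<open>A chord cuts a cycle into two; unless one of them is a chordless cycle of length at
  least 6, both have length 4 and the cycle with its chord is a domino.\<close>

lemma (in bipartite_adjacency) not_distance_hereditary_if_cycle:
  assumes cyc: "cycle_with_chords E v L C" and L: "6 \<le> L" and C: "C \<subseteq> {(i, j)}"
    and ij: "i < j" "j < L"
  shows "\<not> distance_hereditary E"
proof
  assume dh: "distance_hereditary E"
  have nocyc: "\<not> cycle_with_chords E w K {}" if "6 \<le> K" for w K
    using dh that by (simp add: distance_hereditary_def)
  have inj: "inj_on v {..<L}" using cyc by (simp add: cycle_with_chords_def)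
  have adj: "E (v k) (v l) \<longleftrightarrow> l = Suc k \<or> (k = 0 \<and> Suc l = L) \<or> (k, l) \<in> C" if "k < l" "l < L" for k l
    using cyc that unfolding cycle_with_chords_def by blast
  have ne: "j \<noteq> Suc i" "\<not> (i = 0 \<and> Suc j = L)" "C = {(i, j)}"
  proof -
    have "\<not> cycle_with_chords E v L {}" by (rule nocyc[OF L])
    then obtain k l where kl: "k < l" "l < L"
        "\<not> (E (v k) (v l) \<longleftrightarrow> l = Suc k \<or> (k = 0 \<and> Suc l = L))"
      using inj unfolding cycle_with_chords_def by auto
    then have "(k, l) \<in> C" "l \<noteq> Suc k" "\<not> (k = 0 \<and> Suc l = L)" using adj[OF kl(1,2)] by blast+
    then show "j \<noteq> Suc i" "\<not> (i = 0 \<and> Suc j = L)" "C = {(i, j)}" using C by auto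
  qed
  have adj: "E (v k) (v l) \<longleftrightarrow> l = Suc k \<or> (k = 0 \<and> Suc l = L) \<or> (k = i \<and> l = j)"
    if "k < l" "l < L" for k l
    using adj[OF that] ne(3) by auto
  \<comment> \<open>The arc from \<open>i\<close> to \<open>j\<close>, closed by the chord.\<close>
  have "cycle_with_chords E (\<lambda>k. v (i + k)) (j - i + 1) {}"
    unfolding cycle_with_chords_def
  proof (intro conjI allI impI)
    show "inj_on (\<lambda>k. v (i + k)) {..<j - i + 1}"
      using ij by (intro inj_onI) (auto dest!: inj_onD[OF inj])
    fix k l assume "k < l \<and> l < j - i + 1"
    then show "E (v (i + k)) (v (i + l)) \<longleftrightarrow> l = Suc k \<or> (k = 0 \<and> Suc l = j - i + 1) \<or> (k, l) \<in> {}"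
    proof -
      have "i + k < i + l" "i + l < L" using \<open>k < l \<and> l < j - i + 1\<close> ij by auto
      note adj[OF this]
      moreover have "(i + l = Suc (i + k) \<or> (i + k = 0 \<and> Suc (i + l) = L) \<or> (i + k = i \<and> i + l = j)) \<longleftrightarrow>
          (l = Suc k \<or> (k = 0 \<and> Suc l = j - i + 1))"
        using \<open>k < l \<and> l < j - i + 1\<close> ij ne(1,2) by linarith
      ultimately show ?thesis by simp
    qed
  qed
  then have A: "j - i + 1 < 6"
    using nocyc[of "j - i + 1" "\<lambda>k. v (i + k)"] by (meson not_le)
  \<comment> \<open>The complementary arc: \<open>g\<close> skips the positions strictly between
    \<open>i\<close> and \<open>j\<close>.\<close>
  define g where "g k = (if k \<le> i then k else k + (j - i - 1))" for k
  have g: "g k < g l" "g l < L" if "k < l" "l < L - (j - i) + 1" for k l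
    using that ij ne(1) by (auto simp: g_def)
  have "cycle_with_chords E (\<lambda>k. v (g k)) (L - (j - i) + 1) {}"
    unfolding cycle_with_chords_def
  proof (intro conjI allI impI)
    show "inj_on (\<lambda>k. v (g k)) {..<L - (j - i) + 1}"
    proof (rule linorder_inj_onI)
      fix k l assume "k < l" "k \<in> {..<L - (j - i) + 1}" "l \<in> {..<L - (j - i) + 1}"
      then show "v (g k) \<noteq> v (g l)"
        using g[of k l] inj_onD[OF inj, of "g k" "g l"] by auto
    qed auto
    fix k l assume kl: "k < l \<and> l < L - (j - i) + 1"
    then have "g k < g l" "g l < L" using g by blast+
    note adj[OF this]
    moreover have "(g l = Suc (g k) \<or> (g k = 0 \<and> Suc (g l) = L) \<or> (g k = i \<and> g l = j)) \<longleftrightarrow>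
        (l = Suc k \<or> (k = 0 \<and> Suc l = L - (j - i) + 1))"
      using kl ij ne by (auto simp: g_def)
    ultimately show "E (v (g k)) (v (g l)) \<longleftrightarrow>
        l = Suc k \<or> (k = 0 \<and> Suc l = L - (j - i) + 1) \<or> (k, l) \<in> {}" by simp
  qed
  then have B: "L - (j - i) + 1 < 6"
    using nocyc[of "L - (j - i) + 1" "\<lambda>k. v (g k)"] by (meson not_le)
  have "side (v i) \<noteq> side (v j)" using adj[OF ij] side by blast
  then have odd1: "odd (j - i)"
    using side_along_cycle[OF cyc, of i] side_along_cycle[OF cyc, of j] ij by auto
  have "E (v 0) (v (L - 1))" using adj[of 0 "L - 1"] L by auto
  then have odd2: "odd (L - 1)" using side[of "v 0" "v (L - 1)"] side_along_cycle[OF cyc, of "L - 1"] L by auto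
  \<comment> \<open>Both arcs give cycles of length less than 6, and parity leaves length 4 for
    each: a hexagon with a chord between opposite vertices.\<close>
  have "j - i = 2 \<or> j - i = 3 \<or> j - i = 4" using A ij ne(1) by linarith
  then have "j - i = 3" using odd1 by (metis even_numeral)
  then have j: "j = i + 3" by simp
  then have "L = 6 \<or> L = 7" using B L by linarith
  then have L6: "L = 6" "j = i + 3" using odd2 j by auto
  have e: "E (v 0) (v 1)" "E (v 1) (v 2)" "E (v 2) (v 3)" "E (v 3) (v 4)" "E (v 4) (v 5)" "E (v 0) (v 5)"
    using adj[of 0 1] adj[of 1 2] adj[of 2 3] adj[of 3 4] adj[of 4 5] adj[of 0 5] L6 by auto
  note e = e e[THEN sym]
  have nd: "\<not> cycle_with_chords E w 6 {(0, 3)}" for w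
    using dh by (simp add: distance_hereditary_def)
  \<comment> \<open>A rotation takes the chord to the middle edge of the domino.\<close>
  have "i = 0 \<or> i = 1 \<or> i = 2" using ij L6 by auto
  then show False
  proof (elim disjE)
    assume i: "i = 0"
    then have "E (v 0) (v 3)" "\<not> E (v 1) (v 4)" "\<not> E (v 2) (v 5)"
      using adj[of 0 3] adj[of 1 4] adj[of 2 5] L6 by auto
    then show False using domino_cycle[of "v 0" "v 1" "v 2" "v 3" "v 4" "v 5"] e nd by blast
  next
    assume i: "i = 1"
    then have "\<not> E (v 0) (v 3)" "E (v 1) (v 4)" "\<not> E (v 2) (v 5)"
      using adj[of 0 3] adj[of 1 4] adj[of 2 5] L6 by auto
    then show False using domino_cycle[of "v 1" "v 2" "v 3" "v 4" "v 5" "v 0"] e nd sym by blast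
  next
    assume i: "i = 2"
    then have "\<not> E (v 0) (v 3)" "\<not> E (v 1) (v 4)" "E (v 2) (v 5)"
      using adj[of 0 3] adj[of 1 4] adj[of 2 5] L6 by auto
    then show False using domino_cycle[of "v 2" "v 3" "v 4" "v 5" "v 0" "v 1"] e nd sym by blast
  qed
qed

lemma qi_graph_edge_iff: "{a, b} \<in> snd (qi_graph m n S) \<longleftrightarrow> qi_adj S a b"
  by (cases a; cases b) (auto simp: qi_graph_def doubleton_eq_iff)

lemma bipartite_qi_graph: "S \<subseteq> {1..m} \<times> {1..n} \<Longrightarrow> bipartite (qi_graph m n S)"
  unfolding bipartite_def
  by (rule exI[of _ "Inl ` {1..m}"], rule exI[of _ "Inr ` {1..n}"]) (auto simp: qi_graph_def)

lemma qi_graph_edge_cases: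
  fixes L :: nat
  assumes "e \<in> snd (qi_graph m n S)" "e \<subseteq> c ` {..<L}"
  obtains i j where "i < j" "j < L" "e = {c i, c j}" "qi_adj S (c i) (c j)"
proof -
  obtain a b where e: "e = {a, b}" "a \<noteq> b" using assms(1) by (auto simp: qi_graph_def)
  obtain i j where ij: "i < L" "j < L" "a = c i" "b = c j" using assms(2) e by auto
  then have "i \<noteq> j" using e by auto
  then consider "i < j" | "j < i" by linarith
  then show thesis
  proof cases
    case 1
    show thesis by (rule that[OF 1]) (use ij e assms(1) qi_graph_edge_iff in auto)
  next
    case 2
    have "e = {c j, c i}" using ij e by auto
    then show thesis
      by (intro that[OF 2]) (use ij e assms(1) qi_graph_edge_iff in auto)
  qed
qed

text \<open>A forbidden subgraph is a cycle of length at least 6 with no chord or just one.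
  Conversely, a long cycle with fewer than two chords is excluded by
  \<open>not_distance_hereditary_if_cycle\<close>.\<close>

lemma doubly_chordal_bipartite_iff:
  assumes S: "S \<subseteq> {1..m} \<times> {1..n}"
  shows "doubly_chordal_bipartite (qi_graph m n S) \<longleftrightarrow> distance_hereditary (qi_adj S)"
proof
  let ?G = "qi_graph m n S"
  interpret bipartite_adjacency "qi_adj S" isl by (rule bipartite_adjacency_qi_adj)
  have vert: "a \<in> fst ?G" if "qi_adj S a b" for a b
    using that S by (cases a; cases b) (auto simp: qi_graph_def)
  {
    assume dcb: "doubly_chordal_bipartite ?G"
    have no: False if cyc: "cycle_with_chords (qi_adj S) v L C" and L: "6 \<le> L" and C: "C \<subseteq> {(0, 3)}"
      for v L C
    proof -
      define c where "c = map v [0..<L]"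
      have c: "length c = L" "\<And>k. k < L \<Longrightarrow> c ! k = v k" "set c = v ` {..<L}"
        by (auto simp: c_def)
      have inj: "inj_on v {..<L}" using cyc by (simp add: cycle_with_chords_def)
      have adj: "qi_adj S (v k) (v l) \<longleftrightarrow> l = Suc k \<or> (k = 0 \<and> Suc l = L) \<or> (k, l) \<in> C"
        if "k < l" "l < L" for k l
        using cyc that unfolding cycle_with_chords_def by blast
      have step: "qi_adj S (v k) (v (Suc k mod L))" if "k < L" for k
      proof (cases "Suc k = L")
        case True
        then show ?thesis using adj[of 0 k] L sym[of "v 0" "v k"] by auto
      next
        case False
        then show ?thesis using adj[of k "Suc k"] that by auto
      qed
      have ce: "cycle_edges c = {{v k, v (Suc k mod L)} | k. k < L}"
      proof -
        have "c ! (Suc k mod L) = v (Suc k mod L)" for k using L by (intro c(2)) simp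
        then show ?thesis
          unfolding cycle_edges_def c(1) by (intro Collect_cong ex_cong1) (auto simp: c(2))
      qed
      have "is_cycle ?G c"
        unfolding is_cycle_def
      proof (intro conjI)
        show "3 \<le> length c" using c L by simp
        show "distinct c" using inj by (simp add: c_def distinct_map lessThan_atLeast0)
        show "set c \<subseteq> fst ?G" using step vert c(3) by auto
        show "cycle_edges c \<subseteq> snd ?G" unfolding ce using step qi_graph_edge_iff by blast
      qed
      then have "2 \<le> card (chords ?G c)"
        using dcb c(1) L by (simp add: doubly_chordal_bipartite_def)
      moreover have "chords ?G c \<subseteq> {{v 0, v 3}}"
      proof
        fix e assume e: "e \<in> chords ?G c"
        then obtain i j where ij: "i < j" "j < L" "e = {v i, v j}" "qi_adj S (v i) (v j)"
          using qi_graph_edge_cases[of e m n S v L] c(3) by (auto simp: chords_def)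
        have "e \<notin> cycle_edges c" using e by (simp add: chords_def)
        then have nce: "e \<noteq> {v k, v (Suc k mod L)}" if "k < L" for k
          using that unfolding ce by blast
        have "j \<noteq> Suc i" using nce[of i] ij by auto
        moreover have "\<not> (i = 0 \<and> Suc j = L)" using nce[of j] ij by auto
        ultimately have "(i, j) \<in> C" using ij adj by blast
        then show "e \<in> {{v 0, v 3}}" using C ij by auto
      qed
      then have "card (chords ?G c) \<le> 1" using card_mono[of "{{v 0, v 3}}"] by simp
      ultimately show False by simp
    qed
    show "distance_hereditary (qi_adj S)"
      unfolding distance_hereditary_def using no[of _ _ "{}"] no[of _ 6 "{(0, 3)}"] by auto
  }
  {
    assume dh: "distance_hereditary (qi_adj S)"
    have "2 \<le> card (chords ?G c)" if cyc: "is_cycle ?G c" and L: "6 \<le> length c" for c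
    proof (rule ccontr)
      assume "\<not> 2 \<le> card (chords ?G c)"
      moreover have "finite (chords ?G c)"
        by (rule finite_subset[of _ "Pow (set c)"]) (auto simp: chords_def)
      ultimately have one: "e = e'" if "e \<in> chords ?G c" "e' \<in> chords ?G c" for e e'
        using card_le_Suc0_iff_eq[of "chords ?G c"] that by auto
      let ?L = "length c" and ?v = "\<lambda>k. c ! k"
      have inj: "inj_on ?v {..<?L}"
        using cyc by (auto simp: is_cycle_def inj_on_def nth_eq_iff_index_eq)
      have setc: "set c = ?v ` {..<?L}" by (auto simp: set_conv_nth)
      define C where "C = {(i, j). i < j \<and> j < ?L \<and> {?v i, ?v j} \<in> chords ?G c}"
      have step: "qi_adj S (?v k) (?v (Suc k mod ?L))" if "k < ?L" for k
        using cyc that unfolding is_cycle_def cycle_edges_def qi_graph_edge_iff[symmetric, where m = m and n = n] by blast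
      have adj: "qi_adj S (?v i) (?v j) \<longleftrightarrow> j = Suc i \<or> (i = 0 \<and> Suc j = ?L) \<or> (i, j) \<in> C"
        if ij: "i < j" "j < ?L" for i j
      proof
        assume a: "qi_adj S (?v i) (?v j)"
        show "j = Suc i \<or> (i = 0 \<and> Suc j = ?L) \<or> (i, j) \<in> C"
        proof (rule ccontr)
          assume n: "\<not> ?thesis"
          then have "{?v i, ?v j} \<notin> chords ?G c" using ij by (auto simp: C_def)
          then have "{?v i, ?v j} \<in> cycle_edges c"
            using a ij qi_graph_edge_iff by (auto simp: chords_def)
          then obtain k where k: "k < ?L" "{?v i, ?v j} = {?v k, ?v (Suc k mod ?L)}"
            by (auto simp: cycle_edges_def)
          have k': "Suc k mod ?L < ?L" using k by (intro mod_less_divisor) auto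
          have "(i = k \<and> j = Suc k mod ?L) \<or> (j = k \<and> i = Suc k mod ?L)"
            using k ij k' inj_onD[OF inj] unfolding doubleton_eq_iff by auto
          then show False using n k(1) ij by (cases "Suc k = ?L") auto
        qed
      next
        assume "j = Suc i \<or> (i = 0 \<and> Suc j = ?L) \<or> (i, j) \<in> C"
        then show "qi_adj S (?v i) (?v j)"
        proof (elim disjE conjE)
          assume "j = Suc i" then show ?thesis using step[of i] ij by auto
        next
          assume "i = 0" "Suc j = ?L" then show ?thesis using step[of j] ij by (auto intro: sym)
        next
          assume "(i, j) \<in> C" then show ?thesis
            using qi_graph_edge_iff by (auto simp: C_def chords_def)
        qed
      qed
      have cyc': "cycle_with_chords (qi_adj S) ?v ?L C"
        unfolding cycle_with_chords_def using inj adj by blast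
      show False
      proof (cases "C = {}")
        case True
        then show False using cyc' L dh by (auto simp: distance_hereditary_def)
      next
        case False
        then obtain i j where ij: "(i, j) \<in> C" by auto
        \<comment> \<open>Chords are unordered, but the pairs in \<open>C\<close> are increasing, so
          one chord gives one pair.\<close>
        have "C \<subseteq> {(i, j)}"
        proof clarify
          fix k l assume kl: "(k, l) \<in> C"
          have lt: "i < j" "j < ?L" "k < l" "l < ?L" using ij kl by (auto simp: C_def)
          have "{?v i, ?v j} = {?v k, ?v l}"
            using one[of "{?v i, ?v j}" "{?v k, ?v l}"] ij kl by (auto simp: C_def)
          then show "k = i \<and> l = j"
            using lt inj_onD[OF inj, of i l] inj_onD[OF inj, of j k] inj_onD[OF inj, of i k]
              inj_onD[OF inj, of j l] unfolding doubleton_eq_iff by auto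
        qed
        then show False
          using not_distance_hereditary_if_cycle[OF cyc' L] ij dh by (auto simp: C_def)
      qed
    qed
    then show "doubly_chordal_bipartite ?G"
      using bipartite_qi_graph[OF S] by (simp add: doubly_chordal_bipartite_def)
  }
qed

section \<open>Growth of the likelihood estimate along a curve\<close>

text \<open>On a closed walk both products run once over each of \<open>z 0\<close>, ...,
  \<open>z (2 * l - 1)\<close>. This is the binomial equation of the model attached to an even
  cycle.\<close>

lemma alternating_products:
  fixes z :: "nat \<Rightarrow> real"
  assumes "z (2 * l) = z 0"
  shows "(\<Prod>i<l. z (2 * i) * z (Suc (2 * i))) = (\<Prod>i<l. z (Suc (2 * i)) * z (Suc (Suc (2 * i))))"
proof -
  have "(\<Prod>i<l. z (2 * i)) = (\<Prod>i<l. z (Suc (Suc (2 * i))))"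
  proof (cases l)
    case (Suc k)
    have "(\<Prod>i<Suc k. z (2 * i)) = z 0 * (\<Prod>i<k. z (Suc (Suc (2 * i))))"
      by (simp add: prod.lessThan_Suc_shift del: prod.lessThan_Suc)
    also have "\<dots> = (\<Prod>i<Suc k. z (Suc (Suc (2 * i))))"
      using assms Suc by (simp add: mult.commute)
    finally show ?thesis using Suc by simp
  qed simp
  then show ?thesis by (simp add: prod.distrib mult.commute)
qed

text \<open>Counts of order \<open>t ^ cycle_exponent i\<close> on the edges of a chordless cycle force the estimate
  on edge \<open>0\<close> to grow like \<open>sqrt t\<close>.\<close>

definition cycle_exponent :: "nat \<Rightarrow> nat" where
  "cycle_exponent i = (if i = 0 \<or> i = 2 then 0 else if i = 4 then 2 else 1)"

text \<open>With \<open>l = k + 3\<close>, the even edges have exponents 0, 0, 2, 1, 1, ... of sum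
  \<open>l - 1\<close>, one less than the sum over the odd edges. The deviation shared by edges 0
  and 2 has to supply the missing factor \<open>t\<close> by its square. With 1 in place of the 2 it
  would be of order \<open>t\<close>, and no contradiction would arise.\<close>

lemma sum_cycle_exponent: "(\<Sum>i<Suc (Suc (Suc k)). cycle_exponent (2 * i)) = Suc (Suc k)"
  by (induction k) (simp_all add: cycle_exponent_def eval_nat_numeral)

lemma cycle_exponent_odd: "odd i \<Longrightarrow> cycle_exponent i = 1"
  by (auto simp: cycle_exponent_def intro: odd_pos)

text \<open>One value of \<open>t\<close> at a time. The constants \<open>K\<close> and
  \<open>M\<close> will be the same for all \<open>t\<close>, so any upper bound on \<open>t\<close>
  in terms of them is a contradiction for large \<open>t\<close>.\<close>

locale cycle_growth =
  fixes z c :: "nat \<Rightarrow> real" and k l :: nat and K M t :: real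
  assumes l: "l = Suc (Suc (Suc k))"
    and c: "\<And>i. i < 2 * l \<Longrightarrow> 1 \<le> c i" "\<And>i. i < 2 * l \<Longrightarrow> c i \<le> M"
    and t: "1 \<le> t" and K: "0 \<le> K"
    and z: "\<And>i. 0 < z i" "z (2 * l) = z 0"
    and marg: "\<And>i. Suc i < 2 * l \<Longrightarrow>
      \<bar>(z i * z (Suc i) - c i * t ^ cycle_exponent i) +
       (z (Suc i) * z (Suc (Suc i)) - c (Suc i) * t ^ cycle_exponent (Suc i))\<bar> \<le> K"
begin

definition x :: "nat \<Rightarrow> real" where "x i = z i * z (Suc i)"
definition \<delta> :: "nat \<Rightarrow> real" where "\<delta> i = x i - c i * t ^ cycle_exponent i"
definition B :: real where "B = real (2 * l) * K"

lemma x_pos: "0 < x i" using z(1) by (simp add: x_def)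

lemma M: "1 \<le> M" using c[of 0] l by simp

lemma B: "0 \<le> B" using K by (simp add: B_def)

lemma products: "(\<Prod>i<l. x (2 * i)) = (\<Prod>i<l. x (Suc (2 * i)))"
  unfolding x_def by (rule alternating_products[OF z(2)])

text \<open>At each vertex the deviations of its two edges cancel up to \<open>K\<close>, and the
  errors add up along the cycle.\<close>

lemma delta: "i < 2 * l \<Longrightarrow> \<bar>\<delta> i - (- 1) ^ i * \<delta> 0\<bar> \<le> B"
proof -
  have "\<bar>\<delta> i - (- 1) ^ i * \<delta> 0\<bar> \<le> real i * K" if "i < 2 * l" for i
    using that
  proof (induction i)
    case (Suc i)
    have "\<bar>\<delta> i + \<delta> (Suc i)\<bar> \<le> K" using marg[OF Suc.prems] by (simp add: \<delta>_def x_def)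
    moreover have "\<bar>\<delta> i - (- 1) ^ i * \<delta> 0\<bar> \<le> real i * K" using Suc by simp
    ultimately have "\<bar>\<delta> (Suc i) + (- 1) ^ i * \<delta> 0\<bar> \<le> real i * K + K" by linarith
    then show ?case by (simp add: algebra_simps)
  qed simp
  moreover have "real i * K \<le> B" if "i < 2 * l"
    unfolding B_def using that K by (intro mult_right_mono) auto
  ultimately show "i < 2 * l \<Longrightarrow> \<bar>\<delta> i - (- 1) ^ i * \<delta> 0\<bar> \<le> B" by fastforce
qed

lemma delta_even: "i < l \<Longrightarrow> \<bar>\<delta> (2 * i) - \<delta> 0\<bar> \<le> B"
  using delta[of "2 * i"] by simp

lemma delta_odd: "i < l \<Longrightarrow> \<bar>\<delta> (Suc (2 * i)) + \<delta> 0\<bar> \<le> B"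
  using delta[of "Suc (2 * i)"] by simp

lemma delta_0: "- M \<le> \<delta> 0"
  using c(2)[of 0] x_pos[of 0] l by (simp add: \<delta>_def cycle_exponent_def)

lemma x_0: "x 0 = c 0 + \<delta> 0"
  by (simp add: \<delta>_def cycle_exponent_def)

lemma x_odd: "x (Suc (2 * i)) = c (Suc (2 * i)) * t + \<delta> (Suc (2 * i))"
  by (simp add: \<delta>_def cycle_exponent_odd)

text \<open>If edge 0 is bounded, so are all deviations. The odd edges then multiply to order
  \<open>t ^ l\<close>, the even ones only to order \<open>t ^ (l - 1)\<close>.\<close>

lemma bounded:
  assumes Q: "x 0 \<le> Q" and R: "R = B + Q + M" and large: "2 * R \<le> t"
  shows "t \<le> (2 * (M + R)) ^ l"
proof -
  let ?A = "M + R"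
  have "\<bar>\<delta> 0\<bar> \<le> Q + M"
    using c(1)[of 0] delta_0 x_0 Q l x_pos[of 0] M by linarith
  have Rpos: "0 \<le> R" using B M Q x_pos[of 0] R by linarith
  have even: "x (2 * i) \<le> ?A * t ^ cycle_exponent (2 * i)" if i: "i < l" for i
  proof -
    have p: "1 \<le> t ^ cycle_exponent (2 * i)" using t by simp
    have "x (2 * i) \<le> c (2 * i) * t ^ cycle_exponent (2 * i) + R"
      using delta_even[OF i] \<open>\<bar>\<delta> 0\<bar> \<le> Q + M\<close> by (simp add: \<delta>_def R)
    also have "\<dots> \<le> M * t ^ cycle_exponent (2 * i) + R * t ^ cycle_exponent (2 * i)"
      using c(2)[of "2 * i"] i p Rpos mult_left_mono[OF p Rpos]
      by (intro add_mono mult_right_mono) auto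
    finally show ?thesis by (simp add: algebra_simps)
  qed
  have odd: "t / 2 \<le> x (Suc (2 * i))" if i: "i < l" for i
  proof -
    have "1 * t \<le> c (Suc (2 * i)) * t"
      using c(1)[of "Suc (2 * i)"] i t by (intro mult_right_mono) auto
    then show ?thesis
      using delta_odd[OF i] \<open>\<bar>\<delta> 0\<bar> \<le> Q + M\<close> x_odd[of i] large by (simp add: R)
  qed
  have "(t / 2) ^ l = (\<Prod>i<l. t / 2)" by simp
  also have "\<dots> \<le> (\<Prod>i<l. x (Suc (2 * i)))"
    using odd t by (intro prod_mono) auto
  also have "\<dots> \<le> (\<Prod>i<l. ?A * t ^ cycle_exponent (2 * i))"
    unfolding products[symmetric] using even x_pos by (intro prod_mono) (auto intro: less_imp_le)
  also have "\<dots> = ?A ^ l * t ^ Suc (Suc k)"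
    unfolding prod.distrib power_sum[symmetric] l sum_cycle_exponent by simp
  finally have "t ^ l \<le> 2 ^ l * (?A ^ l * t ^ Suc (Suc k))"
    by (simp add: power_divide divide_le_eq mult.commute)
  moreover have "t ^ l = t ^ Suc (Suc k) * t" by (simp add: l)
  ultimately have "t ^ Suc (Suc k) * t \<le> t ^ Suc (Suc k) * (2 * ?A) ^ l"
    unfolding power_mult_distrib[of 2 ?A] by (simp only: mult_ac)
  then show ?thesis using t by (simp only: mult_le_cancel_left_pos zero_less_power)
qed

text \<open>If edge 0 grows linearly, so does edge 2, whose deviation is nearly the same, and the
  even edges multiply to order at least \<open>t ^ Suc l\<close>. The odd edges multiply to order at
  most \<open>t ^ l\<close>, since \<open>\<delta> 0\<close> is bounded below.\<close>

lemma linear: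
  assumes a: "a * t \<le> x 0" "0 < a" "a \<le> 1" and large: "2 * (M + B) / a \<le> t"
  shows "t \<le> ((2 * M + B) / (a / 2)) ^ l"
proof -
  let ?A = "2 * M + B" and ?a = "a / 2"
  \<comment> \<open>The exponents of the even edges, with 1 in place of 0 on edges 0 and 2.\<close>
  define e where "e i = (if i \<le> 1 then 1 else cycle_exponent (2 * i))" for i
  have "a * (2 * (M + B) / a) \<le> a * t" using large a(2) by (intro mult_left_mono) auto
  then have at: "2 * (M + B) \<le> a * t" using a(2) by simp
  have "a * t \<le> 1 * t" using a(3) t by (intro mult_right_mono) auto
  then have at': "2 * (M + B) \<le> t" using at by simp
  have even: "?a * t ^ e i \<le> x (2 * i)" if i: "i < l" for i
  proof (cases "i \<le> 1")
    case True
    then have xi: "x (2 * i) = c (2 * i) + \<delta> (2 * i)"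
      by (auto simp: \<delta>_def cycle_exponent_def)
    have "a * t - M - B \<le> x (2 * i)"
      using xi delta_even[OF i] x_0 a(1) c(1)[of "2 * i"] c(2)[of 0] i by linarith
    then show ?thesis using True at by (simp add: e_def)
  next
    case False
    then have e1: "1 \<le> e i" by (simp add: e_def cycle_exponent_def)
    have "t ^ 1 \<le> t ^ e i" using t e1 by (rule power_increasing[rotated])
    then have "M + B \<le> t ^ e i / 2" using at' by simp
    moreover have "1 * t ^ e i \<le> c (2 * i) * t ^ e i"
      using c(1)[of "2 * i"] i t by (intro mult_right_mono) auto
    moreover have "x (2 * i) = c (2 * i) * t ^ e i + \<delta> (2 * i)"
      using False by (simp add: \<delta>_def e_def)
    ultimately have "t ^ e i / 2 \<le> x (2 * i)"
      using delta_even[OF i] delta_0 by linarith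
    moreover have "?a * t ^ e i \<le> 1 / 2 * t ^ e i"
      using a(3) t by (intro mult_right_mono) auto
    ultimately show ?thesis by simp
  qed
  have odd: "x (Suc (2 * i)) \<le> ?A * t" if i: "i < l" for i
  proof -
    have "x (Suc (2 * i)) \<le> c (Suc (2 * i)) * t + (M + B)"
      using delta_odd[OF i] delta_0 x_odd[of i] by linarith
    also have "\<dots> \<le> M * t + (M + B) * t"
      using c(2)[of "Suc (2 * i)"] i t M B mult_left_mono[OF t, of "M + B"]
      by (intro add_mono mult_right_mono) auto
    finally show ?thesis by (simp add: algebra_simps)
  qed
  have e: "(\<Sum>i<l. e i) = Suc l"
  proof -
    have "(\<Sum>i<l. e i) = (\<Sum>i<l. cycle_exponent (2 * i) + of_bool (i \<le> 1))"
      by (intro sum.cong refl) (auto simp: e_def cycle_exponent_def)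
    also have "\<dots> = Suc (Suc k) + (\<Sum>i<l. of_bool (i \<le> 1))"
      unfolding sum.distrib l sum_cycle_exponent ..
    also have "(\<Sum>i<l. of_bool (i \<le> 1) :: nat) = (\<Sum>i\<in>{0, 1::nat}. 1)"
      using l by (intro sum.mono_neutral_cong_right) auto
    finally show ?thesis using l by simp
  qed
  have "?a ^ l * t ^ Suc l = (\<Prod>i<l. ?a * t ^ e i)"
    unfolding prod.distrib power_sum[symmetric] e by simp
  also have "\<dots> \<le> (\<Prod>i<l. x (2 * i))"
    using even t a(2) by (intro prod_mono) auto
  also have "\<dots> \<le> (\<Prod>i<l. ?A * t)"
    unfolding products using odd x_pos by (intro prod_mono) (auto intro: less_imp_le)
  also have "\<dots> = ?A ^ l * t ^ l" by (simp add: power_mult_distrib)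
  finally have "t ^ l * (?a ^ l * t) \<le> t ^ l * ?A ^ l" by (simp only: power_Suc mult_ac)
  then have "?a ^ l * t \<le> ?A ^ l" using t by (simp only: mult_le_cancel_left_pos zero_less_power)
  then show ?thesis
    unfolding power_divide[of ?A ?a] using a(2) by (subst pos_le_divide_eq) (simp_all add: mult.commute)
qed

end

section \<open>Growth estimates on the domino\<close>

lemma minus_le_of_abs: "- b \<le> a" if "\<bar>a\<bar> \<le> b" for a b :: real
  using that by linarith

text \<open>In the domino the chord \<open>x03\<close> stays bounded because \<open>x45\<close> dominates.\<close>

locale domino_growth =
  fixes x01 x12 x23 x34 x45 x05 x03 c01 c12 c23 c34 c45 c05 c03 K M t :: real
  assumes pos: "0 < x01" "0 < x12" "0 < x23" "0 < x34" "0 < x45" "0 < x05" "0 < x03"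
    and c: "1 \<le> c01" "1 \<le> c12" "1 \<le> c23" "1 \<le> c34" "1 \<le> c45" "1 \<le> c05" "1 \<le> c03"
      "c01 \<le> M" "c12 \<le> M" "c23 \<le> M" "c34 \<le> M" "c45 \<le> M" "c05 \<le> M" "c03 \<le> M"
    and t: "1 \<le> t" and K: "0 \<le> K"
    and v1: "\<bar>(x01 - c01) + (x12 - c12 * t)\<bar> \<le> K"
    and v2: "\<bar>(x12 - c12 * t) + (x23 - c23)\<bar> \<le> K"
    and v4: "\<bar>(x34 - c34 * t ^ 2) + (x45 - c45 * t ^ 3)\<bar> \<le> K"
    and v5: "\<bar>(x45 - c45 * t ^ 3) + (x05 - c05 * t)\<bar> \<le> K"
    and v0: "\<bar>(x01 - c01) + (x05 - c05 * t) + (x03 - c03)\<bar> \<le> K"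
    and v3: "\<bar>(x23 - c23) + (x34 - c34 * t ^ 2) + (x03 - c03)\<bar> \<le> K"
    and prods: "x01 * x23 = x12 * x03" "x03 * x45 = x34 * x05"
    and large: "4 * K + 4 * M \<le> t"
begin

definition n12 :: real where "n12 = c12 * t"
definition n05 :: real where "n05 = c05 * t"
definition n34 :: real where "n34 = c34 * t ^ 2"
definition n45 :: real where "n45 = c45 * t ^ 3"

lemmas n_defs = n12_def n05_def n34_def n45_def
lemmas v0' = abs_le_D1[OF v0, folded n_defs] minus_le_of_abs[OF v0, folded n_defs]
lemmas v1' = abs_le_D1[OF v1, folded n_defs] minus_le_of_abs[OF v1, folded n_defs]
lemmas v2' = abs_le_D1[OF v2, folded n_defs] minus_le_of_abs[OF v2, folded n_defs]
lemmas v3' = abs_le_D1[OF v3, folded n_defs] minus_le_of_abs[OF v3, folded n_defs]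
lemmas v5' = abs_le_D1[OF v5, folded n_defs] minus_le_of_abs[OF v5, folded n_defs]

text \<open>The additive errors \<open>2 * M + 2 * K\<close> are absorbed into the leading
  coefficient \<open>M\<close>.\<close>

definition A :: real where "A = 3 * M + 2 * K"

lemma M: "1 \<le> M" using c by linarith
lemma A: "1 \<le> A" using M K by (simp add: A_def)

lemma t_powers: "t \<le> t ^ 2" "t \<le> t ^ 3" "1 \<le> t ^ 2"
  using t power_increasing[of 1 2 t] power_increasing[of 1 3 t] by auto

lemma count_bounds:
  "t \<le> n12" "n12 \<le> M * t" "t \<le> n05" "n05 \<le> M * t" "t ^ 2 \<le> n34" "n34 \<le> M * t ^ 2"
  "t ^ 3 \<le> n45" "n45 \<le> M * t ^ 3"
  unfolding n_defs using c t by (auto intro: mult_right_mono)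

lemma le_A: "u \<le> A * p" if "u \<le> M * p + (2 * M + 2 * K)" "1 \<le> p" for u p
proof -
  have "(2 * M + 2 * K) * 1 \<le> (2 * M + 2 * K) * p"
    using that M K by (intro mult_left_mono) auto
  then show ?thesis using that by (simp add: A_def algebra_simps)
qed

lemma x05_le: "x05 \<le> A * t"
  by (rule le_A[OF _ t]) (use v0' pos c count_bounds t K in linarith)

lemma x12_le: "x12 \<le> A * t"
  by (rule le_A[OF _ t]) (use v1' pos c count_bounds t M K in linarith)

lemma x34_le: "x34 \<le> A * t ^ 2"
  by (rule le_A[OF _ t_powers(3)]) (use v3' pos c count_bounds t_powers M K in linarith)

text \<open>Edges 01 and 03 can fall below their counts by at most \<open>M\<close> each, so by
  vertex 0 edge 05 exceeds its count by a bounded amount only, and by vertex 5 edge 45 falls short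
  by a bounded amount only.\<close>

lemma x45_ge: "t ^ 3 / 2 \<le> x45"
proof -
  have "x05 - n05 \<le> K + 2 * M" using v0'(1) pos c by linarith
  then have "t ^ 3 - 2 * K - 2 * M \<le> x45" using v5'(2) count_bounds(7) by linarith
  then show ?thesis using large t_powers(2) by linarith
qed

text \<open>The relation \<open>x03 * x45 = x34 * x05\<close> compares order at most 2 + 1 on the
  right with order 3 of \<open>x45\<close>.\<close>

lemma x03_le: "x03 \<le> 2 * A ^ 2"
proof -
  have "x03 * (t ^ 3 / 2) \<le> x03 * x45"
    using x45_ge pos by (intro mult_left_mono) auto
  also have "\<dots> \<le> (A * t ^ 2) * (A * t)"
    unfolding prods using x34_le x05_le pos A t by (intro mult_mono) auto
  finally have "t ^ 3 * x03 \<le> t ^ 3 * (2 * A ^ 2)"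
    by (simp add: power2_eq_square power3_eq_cube mult_ac)
  then show ?thesis using t by (simp only: mult_le_cancel_left_pos zero_less_power)
qed

text \<open>Vertices 1 and 2 transmit the growth of edge 01 to edge 23. Then
  \<open>x01 * x23\<close> is at least of order \<open>t ^ 2\<close>, whereas
  \<open>x12 * x03\<close> is at most of order \<open>t\<close>.\<close>

lemma linear:
  assumes a: "a * t \<le> x01" "0 < a" and at: "4 * (K + M) / a \<le> t"
  shows "t \<le> 4 * A ^ 3 / a ^ 2"
proof -
  have "a * (4 * (K + M) / a) \<le> a * t" using at a(2) by (intro mult_left_mono) auto
  then have at': "4 * K + 4 * M \<le> a * t" using a(2) by simp
  define s where "s = a * t"
  have "s / 2 \<le> x23" using v1' v2' a(1) c at' M K unfolding s_def[symmetric] by linarith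
  then have "a * t / 2 \<le> x23" by (simp add: s_def)
  then have "(a * t) * (a * t / 2) \<le> x01 * x23"
    using a t pos by (intro mult_mono) auto
  also have "\<dots> \<le> (A * t) * (2 * A ^ 2)"
    unfolding prods using x12_le x03_le pos A t by (intro mult_mono) auto
  finally have "t * (a ^ 2 * t) \<le> t * (4 * A ^ 3)"
    by (simp add: power2_eq_square power3_eq_cube mult_ac)
  then have "a ^ 2 * t \<le> 4 * A ^ 3" using t by (simp only: mult_le_cancel_left_pos)
  then show ?thesis using a(2) by (simp add: pos_le_divide_eq mult.commute)
qed

text \<open>With edge 01 bounded, all deviations are bounded, by \<open>x03_le\<close> and the
  margins. The square on 0, 3, 4, 5 then keeps \<open>x03\<close> away from 0, so
  \<open>x12 * x03\<close> is at least of order \<open>t\<close>, but \<open>x01 * x23\<close> is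
  bounded.\<close>

lemma bounded:
  assumes Q: "x01 \<le> Q" and R: "R = 3 * K + Q + 2 * A ^ 2 + 2 * M" and tR: "2 * R \<le> t"
  shows "t \<le> 2 * (4 * (M + R) * (Q * (M + R)))"
proof -
  have A2: "0 \<le> 2 * A ^ 2" by simp
  have Q0: "0 < Q" using Q pos by linarith
  have x12: "t / 2 \<le> x12"
    using v1' Q c count_bounds t tR M K A2 Q0 R by linarith
  have x23: "x23 \<le> M + R"
    using v1' v2' Q c M K A2 R pos by linarith
  have x05: "t / 2 \<le> x05"
    using v0' Q c x03_le count_bounds t tR M K R A2 pos Q0 by linarith
  have x34: "t ^ 2 / 2 \<le> x34"
    using v1' v2' v3' Q c x03_le count_bounds t_powers tR M K R A2 pos Q0 by linarith
  have x45: "x45 \<le> (M + R) * t ^ 3"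
  proof -
    have "R * 1 \<le> R * t ^ 3"
      using M K A2 R Q0 t t_powers by (intro mult_left_mono) auto
    moreover have "x45 \<le> M * t ^ 3 + R"
      using v0' v5' Q c x03_le count_bounds t_powers M K R A2 pos Q0 t by linarith
    ultimately show ?thesis by (simp add: algebra_simps)
  qed
  have MR: "1 \<le> M + R" using M K A2 R Q0 by linarith
  have "(t ^ 2 / 2) * (t / 2) \<le> x34 * x05"
    using x34 x05 t pos by (intro mult_mono) auto
  also have "\<dots> \<le> x03 * ((M + R) * t ^ 3)"
    unfolding prods(2)[symmetric] using x45 pos by (intro mult_left_mono) auto
  finally have "t ^ 3 * 1 \<le> t ^ 3 * (4 * (M + R) * x03)"
    by (simp add: power2_eq_square power3_eq_cube mult_ac)
  then have x03: "1 \<le> 4 * (M + R) * x03" using t by (simp only: mult_le_cancel_left_pos zero_less_power)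
  have "(t / 2) * 1 \<le> x12 * (4 * (M + R) * x03)"
    using x12 x03 t pos by (intro mult_mono) auto
  also have "\<dots> = 4 * (M + R) * (x01 * x23)" unfolding prods by simp
  also have "\<dots> \<le> 4 * (M + R) * (Q * (M + R))"
    using Q x23 pos MR Q0 by (intro mult_left_mono mult_mono) auto
  finally show ?thesis by (simp only: mult_1_right)
qed

end

text \<open>The dichotomy of \<open>rational_function_growth\<close> in the form it takes for
  positive functions; growth like \<open>sqrt t\<close> violates it.\<close>

definition bounded_or_linear :: "(nat \<Rightarrow> real) \<Rightarrow> bool" where
  "bounded_or_linear F \<longleftrightarrow> (\<exists>Q. \<forall>\<^sub>F t in sequentially. F t \<le> Q) \<or>
     (\<exists>a>0. \<forall>\<^sub>F t in sequentially. a * real t \<le> F t)"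

lemma bounded_or_linearE:
  assumes "bounded_or_linear F"
  obtains Q where "\<forall>\<^sub>F t in sequentially. F t \<le> Q"
  | a where "0 < a" "a \<le> 1" "\<forall>\<^sub>F t in sequentially. a * real t \<le> F t"
proof -
  \<comment> \<open>The slope is capped at 1 because the estimate on the cycle assumes
    \<open>a \<le> 1\<close>.\<close>
  have "\<exists>b>0. b \<le> 1 \<and> (\<forall>\<^sub>F t in sequentially. b * real t \<le> F t)"
    if a: "0 < a" "\<forall>\<^sub>F t in sequentially. a * real t \<le> F t" for a
  proof (intro exI[of _ "min a 1"] conjI)
    show "\<forall>\<^sub>F t in sequentially. min a 1 * real t \<le> F t"
      using a(2)
    proof eventually_elim
      case (elim t)
      have "min a 1 * real t \<le> a * real t" by (intro mult_right_mono) auto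
      with elim show ?case by linarith
    qed
  qed (use a in auto)
  then show thesis using assms that unfolding bounded_or_linear_def by blast
qed

lemma not_eventually_le:
  assumes "\<forall>\<^sub>F t in sequentially. real t \<le> C"
  shows False
proof -
  have "\<forall>\<^sub>F t in sequentially. C < real t"
    using filterlim_real_sequentially unfolding filterlim_at_top_dense by blast
  with assms have "\<forall>\<^sub>F t in sequentially. False" by eventually_elim linarith
  then show False by simp
qed

lemma eventually_real_ge: "\<forall>\<^sub>F t in sequentially. C \<le> real t"
  using filterlim_real_sequentially unfolding filterlim_at_top by blast

text \<open>Either alternative of \<open>bounded_or_linear\<close> bounds \<open>t\<close> by a
  constant.\<close>

lemma cycle_growth_contradiction:
  fixes z :: "nat \<Rightarrow> nat \<Rightarrow> real"
  assumes ev: "\<forall>\<^sub>F t in sequentially. cycle_growth (z t) c k l K M (real t)"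
    and bl: "bounded_or_linear (\<lambda>t. z t 0 * z t 1)"
  shows False
  using bl
proof (cases rule: bounded_or_linearE)
  case (1 Q)
  define R where "R = real (2 * l) * K + Q + M"
  have "\<forall>\<^sub>F t in sequentially. real t \<le> (2 * (M + R)) ^ l"
    using ev 1 eventually_real_ge[of "2 * R"]
  proof eventually_elim
    case (elim t)
    interpret cycle_growth "z t" c k l K M "real t" by fact
    show ?case
      by (rule bounded[of Q]) (use elim in \<open>simp_all add: x_def R_def B_def\<close>)
  qed
  then show False by (rule not_eventually_le)
next
  case (2 a)
  define B where "B = real (2 * l) * K"
  have "\<forall>\<^sub>F t in sequentially. real t \<le> ((2 * M + B) / (a / 2)) ^ l"
    using ev 2(3) eventually_real_ge[of "2 * (M + B) / a"]
  proof eventually_elim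
    case (elim t)
    interpret g: cycle_growth "z t" c k l K M "real t" by fact
    have B: "B = g.B" by (simp add: B_def g.B_def)
    show ?case
      unfolding B by (rule g.linear) (use elim 2 in \<open>simp_all add: g.x_def B\<close>)
  qed
  then show False by (rule not_eventually_le)
qed

lemma domino_growth_contradiction:
  fixes x01 x12 x23 x34 x45 x05 x03 :: "nat \<Rightarrow> real"
  assumes ev: "\<forall>\<^sub>F t in sequentially. domino_growth (x01 t) (x12 t) (x23 t) (x34 t) (x45 t) (x05 t) (x03 t)
      c01 c12 c23 c34 c45 c05 c03 K M (real t)"
    and bl: "bounded_or_linear x01"
  shows False
  using bl
proof (cases rule: bounded_or_linearE)
  case (1 Q)
  define A R where "A = 3 * M + 2 * K" and "R = 3 * K + Q + 2 * A ^ 2 + 2 * M"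
  have "\<forall>\<^sub>F t in sequentially. real t \<le> 2 * (4 * (M + R) * (Q * (M + R)))"
    using ev 1 eventually_real_ge[of "2 * R"]
  proof eventually_elim
    case (elim t)
    interpret g: domino_growth "x01 t" "x12 t" "x23 t" "x34 t" "x45 t" "x05 t" "x03 t"
      c01 c12 c23 c34 c45 c05 c03 K M "real t" by fact
    show ?case
      by (rule g.bounded) (use elim in \<open>simp_all add: R_def g.A_def A_def\<close>)
  qed
  then show False by (rule not_eventually_le)
next
  case (2 a)
  define A where "A = 3 * M + 2 * K"
  have "\<forall>\<^sub>F t in sequentially. real t \<le> 4 * A ^ 3 / a ^ 2"
    using ev 2(3) eventually_real_ge[of "4 * (K + M) / a"]
  proof eventually_elim
    case (elim t)
    interpret g: domino_growth "x01 t" "x12 t" "x23 t" "x34 t" "x45 t" "x05 t" "x03 t"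
      c01 c12 c23 c34 c45 c05 c03 K M "real t" by fact
    have A: "A = g.A" by (simp add: A_def g.A_def)
    show ?case unfolding A by (rule g.linear) (use elim 2 in simp_all)
  qed
  then show False by (rule not_eventually_le)
qed

section \<open>Rationality of the maximum likelihood estimate\<close>

lemma mpoly_eval_cong:
  assumes "f \<in> mpolys_in X" "\<And>x. x \<in> X \<Longrightarrow> v x = w x"
  shows "mpoly_eval f v = mpoly_eval f w"
proof -
  have "v x = w x" if "a \<in> Poly_Mapping.keys f" "x \<in> Poly_Mapping.keys a" for a x
    using assms that unfolding mpolys_in_def by blast
  then show ?thesis
    unfolding mpoly_eval_def by (intro sum.cong arg_cong2[where f = "(*)"] prod.cong refl) simp
qed

text \<open>The estimate is the solution of the margin equations divided by the total count. It
  applies whenever all counts are positive, which the product of the variables expresses by not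
  vanishing.\<close>

lemma has_rational_mle_if_distance_hereditary:
  assumes S: "S \<subseteq> {1..m} \<times> {1..n}" and dh: "distance_hereditary (qi_adj S)"
  shows "has_rational_mle S (qi_model m n S)"
proof (cases "S = {}")
  case True
  \<comment> \<open>Without cells the condition on the counts is vacuous, and any nonzero polynomial
    serves.\<close>
  have "(1 :: (nat \<times> nat) real_mpoly) \<noteq> 0" by simp
  then show ?thesis
    unfolding has_rational_mle_def for_generic_counts_def True
    by (intro bexI[of _ "\<lambda>_. 1"] bexI[of _ 1] conjI) (auto simp: mpolys_in_one)
next
  case False
  have fin: "finite S" by (rule finite_subset[OF S]) simp
  obtain y where y: "margin_solution S (qi_adj S) (\<lambda>a b w. w (cell a b)) y"
    using margin_solution_exists[OF bipartite_adjacency_qi_adj dh finite_qi_adj[OF fin],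
        of S "\<lambda>a b w. w (cell a b)"] positive_rational_var[OF cell_in] cell_commute
    by metis
  define F where "F e w = y w (Inl (fst e)) * y w (Inr (snd e)) / (\<Sum>k\<in>S. w k)" for e w
  have "positive_rational S (F e)" if "e \<in> S" for e
    unfolding F_def
  proof (rule positive_rational_divide)
    have "qi_adj S (Inl (fst e)) (Inr (snd e))" using that by simp
    then show "positive_rational S (\<lambda>w. y w (Inl (fst e)) * y w (Inr (snd e)))"
      using y by (simp add: margin_solution_def)
    show "positive_rational S (\<lambda>w. \<Sum>k\<in>S. w k)"
      using fin False by (intro positive_rational_sum positive_rational_var)
  qed
  then have "\<forall>e\<in>S. \<exists>f g. f \<in> mpolys_in S \<and> g \<in> mpolys_in S \<and> (\<forall>w. (\<forall>x\<in>S. w x > 0) \<longrightarrow>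
      mpoly_eval g w > 0 \<and> F e w = mpoly_eval f w / mpoly_eval g w)"
    unfolding positive_rational_def by blast
  from this[unfolded bchoice_iff] obtain f g where "\<forall>e\<in>S. f e \<in> mpolys_in S \<and> g e \<in> mpolys_in S \<and>
      (\<forall>w. (\<forall>x\<in>S. w x > 0) \<longrightarrow> mpoly_eval (g e) w > 0 \<and> F e w = mpoly_eval (f e) w / mpoly_eval (g e) w)"
    by blast
  then have fg: "f \<in> S \<rightarrow> mpolys_in S" "g \<in> S \<rightarrow> mpolys_in S"
    "\<And>e w. e \<in> S \<Longrightarrow> (\<forall>x\<in>S. w x > 0) \<Longrightarrow>
      mpoly_eval (g e) w > 0 \<and> F e w = mpoly_eval (f e) w / mpoly_eval (g e) w"
    by blast+
  let ?h = "\<Prod>e\<in>S. mpoly_var e"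
  have "mpoly_eval ?h (\<lambda>_. 1) = 1" by (simp add: mpoly_eval_prod mpoly_eval_var)
  then have h: "?h \<noteq> 0" by auto
  have mle: "\<forall>e\<in>S. mpoly_eval (g e) (\<lambda>k. real (u k)) \<noteq> 0 \<and>
      (\<exists>p. {q. is_mle S (qi_model m n S) u q} = {p} \<and>
        p e = mpoly_eval (f e) (\<lambda>k. real (u k)) / mpoly_eval (g e) (\<lambda>k. real (u k)))"
    if u: "mpoly_eval ?h (\<lambda>e. real (u e)) \<noteq> 0" for u
  proof -
    let ?w = "\<lambda>k. real (u k)"
    have w: "\<forall>x\<in>S. ?w x > 0"
      using u fin by (simp add: mpoly_eval_prod mpoly_eval_var)
    define N where "N = (\<Sum>k\<in>S. ?w k)"
    have N: "N > 0" unfolding N_def using w fin False by (intro sum_pos) auto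
    \<comment> \<open>The total is divided off at the row vertices only, so each cell is divided
      once.\<close>
    define z where "z a = (if isl a then y ?w a / N else y ?w a)" for a
    define p where "p = (\<lambda>e\<in>S. z (Inl (fst e)) * z (Inr (snd e)))"
    have ypos: "y ?w a > 0" for a using y w by (simp add: margin_solution_def)
    have p_cell: "N * p (cell a b) = y ?w a * y ?w b" if "qi_adj S a b" for a b
      using that N by (cases a; cases b) (auto simp: p_def z_def)
    have marg: "margin S ?w a = N * margin S p a" for a
    proof -
      have "N * margin S p a = (\<Sum>b\<in>{b. qi_adj S a b}. y ?w a * y ?w b)"
        unfolding margin_def sum_distrib_left by (intro sum.cong) (auto simp: p_cell)
      also have "\<dots> = margin S ?w a"
        using y w by (simp add: margin_solution_def margin_def)
      finally show ?thesis by simp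
    qed
    \<comment> \<open>The total is the sum of the row margins, so the margin equations already force
      \<open>p\<close> to sum to 1.\<close>
    have sum: "(\<Sum>e\<in>S. f e) = (\<Sum>a\<in>{1..m} <+> {1..n}. of_bool (isl a) * margin S f a)" for f
      using sum_vertex_potential[OF S, of f "\<lambda>a. of_bool (isl a)"] by simp
    have "N = (\<Sum>a\<in>{1..m} <+> {1..n}. of_bool (isl a) * margin S ?w a)"
      unfolding N_def by (rule sum)
    also have "\<dots> = (\<Sum>a\<in>{1..m} <+> {1..n}. N * (of_bool (isl a) * margin S p a))"
      by (intro sum.cong refl) (simp add: marg)
    also have "\<dots> = N * (\<Sum>e\<in>S. p e)"
      unfolding sum[of p] by (rule sum_distrib_left[symmetric])
    finally have "N = N * (\<Sum>e\<in>S. p e)" .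
    then have "(\<Sum>e\<in>S. p e) = 1" using N by simp
    then have "{q. is_mle S (qi_model m n S) u q} = {p}"
      by (intro mle_of_margins[OF S _ _ _ _ N marg, of z])
        (use ypos N in \<open>auto simp: z_def p_def\<close>)
    moreover have "p e = F e ?w" if "e \<in> S" for e
      using that by (simp add: p_def z_def F_def N_def)
    ultimately show ?thesis using fg(3)[OF _ w] by (metis less_irrefl)
  qed
  show ?thesis
    unfolding has_rational_mle_def for_generic_counts_def
    by (intro bexI[OF _ fg(1)] bexI[OF _ fg(2)] bexI[of _ ?h] conjI ballI impI h mpolys_in_prod mpolys_in_var)
      (use mle in blast)+
qed

text \<open>One vector \<open>c\<close> off the zero set of \<open>h\<close> serves for all
  exponents: at \<open>t = 1\<close> each curve passes through \<open>c\<close>, so \<open>h\<close>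
  does not vanish identically along it and is nonzero for all large \<open>t\<close>.\<close>

lemma rational_mle_growth:
  assumes S: "S \<subseteq> {1..m} \<times> {1..n}" and rat: "has_rational_mle S (qi_model m n S)"
  obtains c :: "nat \<times> nat \<Rightarrow> nat" where "\<And>e. 0 < c e"
    "\<And>d. \<exists>y. (\<forall>\<^sub>F t in sequentially. (\<forall>a. 0 < y t a) \<and>
        (\<forall>a. (\<Sum>b\<in>{b. qi_adj S a b}. y t a * y t b) =
          (\<Sum>b\<in>{b. qi_adj S a b}. real (c (cell a b)) * real t ^ d (cell a b)))) \<and>
      (\<forall>a b. qi_adj S a b \<longrightarrow> bounded_or_linear (\<lambda>t. y t a * y t b))"
proof -
  have fin: "finite S" by (rule finite_subset[OF S]) simp
  obtain f g h where fg: "f \<in> S \<rightarrow> mpolys_in S" "g \<in> S \<rightarrow> mpolys_in S"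
    and h: "h \<in> mpolys_in S" "h \<noteq> 0"
    and mle: "\<And>u. u \<in> S \<rightarrow>\<^sub>E UNIV \<Longrightarrow> mpoly_eval h (\<lambda>i. real (u i)) \<noteq> 0 \<Longrightarrow>
      (\<forall>e\<in>S. mpoly_eval (g e) (\<lambda>k. real (u k)) \<noteq> 0 \<and>
        (\<exists>p. {q. is_mle S (qi_model m n S) u q} = {p} \<and>
          p e = mpoly_eval (f e) (\<lambda>k. real (u k)) / mpoly_eval (g e) (\<lambda>k. real (u k))))"
    using rat unfolding has_rational_mle_def for_generic_counts_def by blast
  obtain c :: "nat \<times> nat \<Rightarrow> nat" where c: "\<And>e. 0 < c e" "mpoly_eval h (\<lambda>e. real (c e)) \<noteq> 0"
    using mpoly_nonzero_at_positive_naturals[OF h fin] by blast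
  show thesis
  proof (rule that[OF c(1)])
    fix d :: "nat \<times> nat \<Rightarrow> nat"
    define w where "w t e = real (c e) * real t ^ d e" for t e
    define N where "N t = (\<Sum>e\<in>S. w t e)" for t
    have curve: "mpoly_eval q (w t) = poly (curve_poly q (\<lambda>e. real (c e)) d) (real t)" for q t
      by (simp add: poly_curve_poly w_def[abs_def])
    let ?h = "curve_poly h (\<lambda>e. real (c e)) d"
    have "poly ?h 1 \<noteq> 0" using c(2) by (simp add: poly_curve_poly)
    then have "?h \<noteq> 0" by auto
    then have "eventually (\<lambda>t. poly ?h (real t) \<noteq> 0) sequentially"
      by (intro eventually_compose_filterlim[OF poly_eventually_not_zero]
          filterlim_at_top_imp_at_infinity filterlim_real_sequentially)
    then have ev: "\<forall>\<^sub>F t in sequentially. 0 < t \<and> mpoly_eval h (w t) \<noteq> 0"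
      unfolding curve using eventually_gt_at_top[of 0] by eventually_elim simp
    define P where "P t y \<longleftrightarrow> (\<forall>a. 0 < y a) \<and>
        (\<forall>a. (\<Sum>b\<in>{b. qi_adj S a b}. y a * y b) = (\<Sum>b\<in>{b. qi_adj S a b}. w t (cell a b))) \<and>
        (\<forall>a b. qi_adj S a b \<longrightarrow> mpoly_eval (g (cell a b)) (w t) \<noteq> 0 \<and>
          y a * y b = N t * mpoly_eval (f (cell a b)) (w t) / mpoly_eval (g (cell a b)) (w t))"
      for t and y :: "nat + nat \<Rightarrow> real"
    have good: "\<exists>y. P t y"
      if t: "0 < t" "mpoly_eval h (w t) \<noteq> 0" for t
    proof (cases "S = {}")
      case True
      then have "qi_adj S a = (\<lambda>_. False)" for a by (auto elim: qi_adj.elims)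
      then show ?thesis unfolding P_def by (intro exI[of _ "\<lambda>_. 1"]) simp
    next
      case False
      define u where "u = (\<lambda>e\<in>S. c e * t ^ d e)"
      have uw: "real (u e) = w t e" if "e \<in> S" for e using that by (simp add: u_def w_def)
      have ev_u: "mpoly_eval q (\<lambda>e. real (u e)) = mpoly_eval q (w t)" if "q \<in> mpolys_in S" for q
        by (rule mpoly_eval_cong[OF that uw])
      have fg_in: "f e \<in> mpolys_in S" "g e \<in> mpolys_in S" if "e \<in> S" for e using fg that by auto
      have "u \<in> S \<rightarrow>\<^sub>E UNIV" "mpoly_eval h (\<lambda>i. real (u i)) \<noteq> 0"
        using t(2) by (simp_all add: u_def[symmetric] ev_u[OF h(1)]) (simp add: u_def)
      note mle = mle[OF this]
      obtain e0 where "e0 \<in> S" using False by auto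
      then obtain p where p: "{q. is_mle S (qi_model m n S) u q} = {p}" using mle by blast
      have pe: "mpoly_eval (g e) (w t) \<noteq> 0 \<and> p e = mpoly_eval (f e) (w t) / mpoly_eval (g e) (w t)"
        if "e \<in> S" for e
        using mle that p fg_in[OF that] by (auto simp: ev_u)
      have "is_mle S (qi_model m n S) u p" using p by blast
      note marg = margins_of_mle[OF S this]
      have Nt: "(\<Sum>e\<in>S. real (u e)) = N t" unfolding N_def by (intro sum.cong) (auto simp: uw)
      have Npos: "0 < N t"
        unfolding N_def w_def using fin False t(1) c(1) by (intro sum_pos) auto
      have "p \<in> qi_model m n S" using p by (auto simp: is_mle_def is_arg_max_def)
      then obtain y where y: "\<And>a. y a > 0" "\<And>e. e \<in> S \<Longrightarrow> p e = y (Inl (fst e)) * y (Inr (snd e))"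
        using qi_model_parameters[OF S] by metis
      \<comment> \<open>Parameters for counts rather than probabilities: the factor
        \<open>N t\<close> sits on the row vertices.\<close>
      define z where "z a = (if isl a then N t * y a else y a)" for a
      have z: "z a * z b = N t * p (cell a b)" if "qi_adj S a b" for a b
        using that y(2) by (cases a; cases b) (auto simp: z_def)
      show ?thesis
        unfolding P_def
      proof (intro exI[of _ z] conjI allI impI)
        show "0 < z a" for a using y(1)[of a] Npos by (simp add: z_def)
        show "(\<Sum>b\<in>{b. qi_adj S a b}. z a * z b) = (\<Sum>b\<in>{b. qi_adj S a b}. w t (cell a b))" for a
        proof -
          have "(\<Sum>b\<in>{b. qi_adj S a b}. z a * z b) = N t * margin S p a"
            unfolding margin_def sum_distrib_left by (intro sum.cong) (auto simp: z)
          also have "\<dots> = margin S (\<lambda>e. real (u e)) a" using marg[of a] Nt by simp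
          also have "\<dots> = (\<Sum>b\<in>{b. qi_adj S a b}. w t (cell a b))"
            unfolding margin_def by (intro sum.cong) (auto simp: uw cell_in)
          finally show ?thesis .
        qed
        show "mpoly_eval (g (cell a b)) (w t) \<noteq> 0" if "qi_adj S a b" for a b
          using pe[OF cell_in[OF that]] by simp
        show "z a * z b = N t * mpoly_eval (f (cell a b)) (w t) / mpoly_eval (g (cell a b)) (w t)"
          if "qi_adj S a b" for a b
          using z[OF that] pe[OF cell_in[OF that]] by simp
      qed
    qed
    obtain y where y: "\<And>t. 0 < t \<Longrightarrow> mpoly_eval h (w t) \<noteq> 0 \<Longrightarrow> P t (y t)"
      using good by metis
    have growth: "bounded_or_linear (\<lambda>t. y t a * y t b)" if ab: "qi_adj S a b" for a b
    proof -
      \<comment> \<open>The total count is a polynomial in \<open>t\<close>, so the estimated count,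
        and not only the probability, is a rational function of \<open>t\<close>.\<close>
      let ?f = "(\<Sum>e\<in>S. monom (real (c e)) (d e)) * curve_poly (f (cell a b)) (\<lambda>e. real (c e)) d"
      let ?g = "curve_poly (g (cell a b)) (\<lambda>e. real (c e)) d"
      have N: "poly (\<Sum>e\<in>S. monom (real (c e)) (d e)) (real t) = N t" for t
        by (simp add: poly_sum poly_monom N_def w_def)
      have eq: "\<forall>\<^sub>F t in sequentially. 0 < y t a * y t b \<and> poly ?g (real t) \<noteq> 0 \<and>
          y t a * y t b = poly ?f (real t) / poly ?g (real t)"
        using ev
      proof eventually_elim
        case (elim t)
        then have P: "P t (y t)" by (intro y) blast+
        then have "0 < y t a" "0 < y t b" by (simp_all add: P_def)
        then have "0 < y t a * y t b" by simp
        moreover have "mpoly_eval (g (cell a b)) (w t) \<noteq> 0"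
          "y t a * y t b = N t * mpoly_eval (f (cell a b)) (w t) / mpoly_eval (g (cell a b)) (w t)"
          using P ab unfolding P_def by blast+
        ultimately show ?case by (simp only: poly_mult N curve) simp
      qed
      obtain t where "poly ?g (real t) \<noteq> 0"
        using eventually_happens[OF eq] by auto
      then have "?g \<noteq> 0" by auto
      from rational_function_growth[OF this, of ?f] show ?thesis
      proof (elim disjE exE conjE)
        fix K assume "\<forall>\<^sub>F t in sequentially. \<bar>poly ?f (real t) / poly ?g (real t)\<bar> \<le> K"
        with eq have "\<forall>\<^sub>F t in sequentially. y t a * y t b \<le> K"
        proof eventually_elim
          case (elim t)
          then show ?case by (metis abs_of_pos)
        qed
        then show ?thesis unfolding bounded_or_linear_def by blast
      next
        fix k :: real assume k: "0 < k" "\<forall>\<^sub>F t in sequentially. k * real t \<le> \<bar>poly ?f (real t) / poly ?g (real t)\<bar>"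
        from eq k(2) have "\<forall>\<^sub>F t in sequentially. k * real t \<le> y t a * y t b"
        proof eventually_elim
          case (elim t)
          then show ?case by (metis abs_of_pos)
        qed
        then show ?thesis using k(1) unfolding bounded_or_linear_def by blast
      qed
    qed
    show "\<exists>y. (\<forall>\<^sub>F t in sequentially. (\<forall>a. 0 < y t a) \<and>
        (\<forall>a. (\<Sum>b\<in>{b. qi_adj S a b}. y t a * y t b) =
          (\<Sum>b\<in>{b. qi_adj S a b}. real (c (cell a b)) * real t ^ d (cell a b)))) \<and>
      (\<forall>a b. qi_adj S a b \<longrightarrow> bounded_or_linear (\<lambda>t. y t a * y t b))"
    proof (intro exI[of _ y] conjI allI impI growth)
      show "\<forall>\<^sub>F t in sequentially. (\<forall>a. 0 < y t a) \<and>
        (\<forall>a. (\<Sum>b\<in>{b. qi_adj S a b}. y t a * y t b) =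
          (\<Sum>b\<in>{b. qi_adj S a b}. real (c (cell a b)) * real t ^ d (cell a b)))"
        using ev
      proof eventually_elim
        case (elim t)
        then have "P t (y t)" by (intro y) blast+
        then show ?case unfolding P_def w_def by blast
      qed
    qed
  qed
qed

text \<open>Edges leaving \<open>W\<close> carry little weight, so the margins inside \<open>W\<close> nearly agree.\<close>

lemma restricted_margins:
  fixes y :: "'v \<Rightarrow> real"
  assumes fin: "\<And>a. finite {b. E a b}" "\<And>a. card {b. E a b} \<le> D" and sym: "\<And>a b. E a b \<Longrightarrow> E b a"
    and y: "\<And>a. 0 < y a"
    and marg: "\<And>a. (\<Sum>b\<in>{b. E a b}. y a * y b) = (\<Sum>b\<in>{b. E a b}. U a b)"
    and U: "\<And>a b. E a b \<Longrightarrow> 0 \<le> U a b"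
    and small: "\<And>a b. E a b \<Longrightarrow> b \<notin> W \<Longrightarrow> U a b \<le> K"
      "\<And>b. b \<notin> W \<Longrightarrow> (\<Sum>a\<in>{a. E b a}. U b a) \<le> K"
    and K: "0 \<le> K"
  shows "\<bar>\<Sum>b\<in>{b \<in> W. E a b}. y a * y b - U a b\<bar> \<le> real D * K"
proof -
  let ?I = "{b \<in> W. E a b}" and ?O = "{b. E a b \<and> b \<notin> W}"
  have split: "{b. E a b} = ?I \<union> ?O" "?I \<inter> ?O = {}" by auto
  have f: "finite ?I" "finite ?O" using fin(1)[of a] by (auto intro: finite_subset[rotated])
  have "(\<Sum>b\<in>{b. E a b}. y a * y b - U a b) = 0" by (simp add: sum_subtractf marg)
  then have "(\<Sum>b\<in>?I. y a * y b - U a b) = - (\<Sum>b\<in>?O. y a * y b - U a b)"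
    unfolding split(1) sum.union_disjoint[OF f split(2)] by linarith
  then have "\<bar>\<Sum>b\<in>?I. y a * y b - U a b\<bar> \<le> (\<Sum>b\<in>?O. \<bar>y a * y b - U a b\<bar>)"
    by (simp add: sum_abs)
  also have "\<dots> \<le> (\<Sum>b\<in>?O. K)"
  proof (rule sum_mono)
    fix b assume b: "b \<in> ?O"
    have "y b * y a \<le> (\<Sum>c\<in>{c. E b c}. y b * y c)"
      using b sym fin(1)[of b] y by (intro member_le_sum) (auto intro: less_imp_le)
    also have "\<dots> \<le> K" using small(2)[of b] b by (simp add: marg)
    finally have "y a * y b \<le> K" by (simp add: mult.commute)
    moreover have "0 < y a * y b" using y by simp
    ultimately show "\<bar>y a * y b - U a b\<bar> \<le> K" using small(1)[of a b] U[of a b] b by auto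
  qed
  also have "\<dots> = real (card ?O) * K" by simp
  also have "\<dots> \<le> real D * K"
  proof -
    have "card ?O \<le> card {b. E a b}" by (rule card_mono[OF fin(1)]) auto
    then show ?thesis using fin(2)[of a] K by (intro mult_right_mono) auto
  qed
  finally show ?thesis .
qed

text \<open>Exponents \<open>d\<close> are placed on the edges among the vertices
  \<open>v i\<close>, and 0 on all others. Vertices outside the pattern then have margins bounded
  independently of \<open>t\<close>, and \<open>restricted_margins\<close> applies with a constant
  error.\<close>

lemma rational_mle_growth_on_pattern:
  fixes v :: "nat \<Rightarrow> nat + nat" and d :: "nat \<Rightarrow> nat \<Rightarrow> nat"
  assumes S: "S \<subseteq> {1..m} \<times> {1..n}" and rat: "has_rational_mle S (qi_model m n S)"
    and inj: "inj_on v {..<L}"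
  obtains c :: "nat \<Rightarrow> nat \<Rightarrow> real" and M K y where
    "0 \<le> K" "\<And>i j. 1 \<le> c i j" "\<And>i j. c i j \<le> M" "\<And>i j. c i j = c j i"
    "\<forall>\<^sub>F t in sequentially. (\<forall>a. 0 < y t a) \<and>
      (\<forall>i<L. \<bar>\<Sum>j\<in>{j. j < L \<and> qi_adj S (v i) (v j)}.
        y t (v i) * y t (v j) - c i j * real t ^ d (min i j) (max i j)\<bar> \<le> K)"
    "\<And>i j. qi_adj S (v i) (v j) \<Longrightarrow> bounded_or_linear (\<lambda>t. y t (v i) * y t (v j))"
proof -
  interpret bipartite_adjacency "qi_adj S" isl by (rule bipartite_adjacency_qi_adj)
  have fin: "finite S" by (rule finite_subset[OF S]) simp
  define ix where "ix = inv_into {..<L} v"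
  have ix: "ix (v i) = i" if "i < L" for i using inj that by (simp add: ix_def)
  define W where "W = v ` {..<L}"
  \<comment> \<open>\<open>d\<close> is only evaluated at increasing pairs of positions, hence
    \<open>min\<close> and \<open>max\<close>.\<close>
  define dd where "dd a b = (if a \<in> W \<and> b \<in> W then d (min (ix a) (ix b)) (max (ix a) (ix b)) else 0)"
    for a b
  define de where "de e = dd (Inl (fst e)) (Inr (snd e))" for e
  have dd_commute: "dd a b = dd b a" for a b by (simp add: dd_def min.commute max.commute)
  have de_cell: "de (cell a b) = dd a b" if "qi_adj S a b" for a b
    using that dd_commute by (cases a; cases b) (auto simp: de_def)
  obtain c where c: "\<And>e. 0 < c e" and ex: "\<And>d. \<exists>y. (\<forall>\<^sub>F t in sequentially. (\<forall>a. 0 < y t a) \<and>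
        (\<forall>a. (\<Sum>b\<in>{b. qi_adj S a b}. y t a * y t b) =
          (\<Sum>b\<in>{b. qi_adj S a b}. real (c (cell a b)) * real t ^ d (cell a b)))) \<and>
      (\<forall>a b. qi_adj S a b \<longrightarrow> bounded_or_linear (\<lambda>t. y t a * y t b))"
    using rational_mle_growth[OF S rat] by blast
  obtain y where y: "\<forall>\<^sub>F t in sequentially. (\<forall>a. 0 < y t a) \<and>
        (\<forall>a. (\<Sum>b\<in>{b. qi_adj S a b}. y t a * y t b) =
          (\<Sum>b\<in>{b. qi_adj S a b}. real (c (cell a b)) * real t ^ de (cell a b)))"
      "\<And>a b. qi_adj S a b \<Longrightarrow> bounded_or_linear (\<lambda>t. y t a * y t b)"
    using ex[of de] by blast
  \<comment> \<open>Bounds each coefficient on \<open>S\<close> and also each margin at a vertex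
    outside \<open>W\<close>.\<close>
  define K0 where "K0 = (\<Sum>e\<in>S. real (c e))"
  define D where "D = card {(a, b). qi_adj S a b}"
  \<comment> \<open>The value 1 at non-edges keeps the bounds on \<open>cc\<close> valid for all
    pairs.\<close>
  define cc where "cc i j = (if qi_adj S (v i) (v j) then real (c (cell (v i) (v j))) else 1)" for i j
  have c_le: "real (c e) \<le> K0" if "e \<in> S" for e
    unfolding K0_def using that fin by (intro member_le_sum) auto
  have K0: "0 \<le> K0" unfolding K0_def by (intro sum_nonneg) auto
  have nb: "{b. qi_adj S a b} \<subseteq> snd ` {(a, b). qi_adj S a b}" for a by force
  note finE = finite_qi_adj[OF fin]
  have fin_nb: "finite {b. qi_adj S a b}" for a
    by (rule finite_subset[OF nb]) (use finE in simp)
  have card_nb: "card {b. qi_adj S a b} \<le> D" for a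
    unfolding D_def using card_mono[OF finite_imageI[OF finE] nb] card_image_le[OF finE, of snd]
    by (rule order_trans)
  show thesis
  proof (rule that[of "real D * K0" cc "K0 + 1" y])
    show "0 \<le> real D * K0" using K0 by simp
    show "1 \<le> cc i j" for i j using c[of "cell (v i) (v j)"] by (simp add: cc_def Suc_le_eq)
    show "cc i j \<le> K0 + 1" for i j
      using c_le[OF cell_in, of "v i" "v j"] K0 by (auto simp: cc_def)
    show "cc i j = cc j i" for i j
      using sym[of "v i" "v j"] sym[of "v j" "v i"] cell_commute[of "v i" "v j"]
      by (simp add: cc_def)
    show "bounded_or_linear (\<lambda>t. y t (v i) * y t (v j))" if "qi_adj S (v i) (v j)" for i j
      using y(2)[OF that] .
    show "\<forall>\<^sub>F t in sequentially. (\<forall>a. 0 < y t a) \<and>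
      (\<forall>i<L. \<bar>\<Sum>j\<in>{j. j < L \<and> qi_adj S (v i) (v j)}.
        y t (v i) * y t (v j) - cc i j * real t ^ d (min i j) (max i j)\<bar> \<le> real D * K0)"
      using y(1)
    proof eventually_elim
      case (elim t)
      define U where "U a b = real (c (cell a b)) * real t ^ dd a b" for a b
      have marg: "(\<Sum>b\<in>{b. qi_adj S a b}. y t a * y t b) = (\<Sum>b\<in>{b. qi_adj S a b}. U a b)" for a
      proof -
        have "(\<Sum>b\<in>{b. qi_adj S a b}. real (c (cell a b)) * real t ^ de (cell a b)) =
            (\<Sum>b\<in>{b. qi_adj S a b}. U a b)"
          by (intro sum.cong refl) (simp add: U_def de_cell)
        then show ?thesis using elim by simp
      qed
      have small1: "U a b \<le> K0" if "qi_adj S a b" "b \<notin> W" for a b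
        using c_le[OF cell_in[OF that(1)]] that(2) by (simp add: U_def dd_def)
      have small2: "(\<Sum>a\<in>{a. qi_adj S b a}. U b a) \<le> K0" if "b \<notin> W" for b
      proof -
        have "(\<Sum>a\<in>{a. qi_adj S b a}. U b a) = margin S (\<lambda>e. real (c e)) b"
          unfolding margin_def using that by (intro sum.cong refl) (simp add: U_def dd_def)
        also have "\<dots> \<le> K0"
          unfolding margin_incident[OF fin] K0_def by (intro sum_mono) auto
        finally show ?thesis .
      qed
      have "\<bar>\<Sum>j\<in>{j. j < L \<and> qi_adj S (v i) (v j)}.
          y t (v i) * y t (v j) - cc i j * real t ^ d (min i j) (max i j)\<bar> \<le> real D * K0"
        if i: "i < L" for i
      proof -
        have "(\<Sum>j\<in>{j. j < L \<and> qi_adj S (v i) (v j)}.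
            y t (v i) * y t (v j) - cc i j * real t ^ d (min i j) (max i j)) =
          (\<Sum>b\<in>{b \<in> W. qi_adj S (v i) b}. y t (v i) * y t b - U (v i) b)"
        proof (rule sum.reindex_cong[where l = v and B = "{j. j < L \<and> qi_adj S (v i) (v j)}", symmetric])
          show "inj_on v {j. j < L \<and> qi_adj S (v i) (v j)}"
            by (rule inj_on_subset[OF inj]) auto
          show "{b \<in> W. qi_adj S (v i) b} = v ` {j. j < L \<and> qi_adj S (v i) (v j)}"
            by (auto simp: W_def)
          show "y t (v i) * y t (v j) - U (v i) (v j) =
              y t (v i) * y t (v j) - cc i j * real t ^ d (min i j) (max i j)"
            if "j \<in> {j. j < L \<and> qi_adj S (v i) (v j)}" for j
            using that i by (simp add: U_def cc_def dd_def ix W_def)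
        qed
        moreover have "\<bar>\<Sum>b\<in>{b \<in> W. qi_adj S (v i) b}. y t (v i) * y t b - U (v i) b\<bar> \<le> real D * K0"
          by (rule restricted_margins[OF fin_nb card_nb sym _ marg _ small1 small2 K0])
            (use elim in \<open>auto simp: U_def\<close>)
        ultimately show ?thesis by simp
      qed
      then show ?case using elim by simp
    qed
  qed
qed

lemma not_rational_if_chordless_cycle:
  assumes S: "S \<subseteq> {1..m} \<times> {1..n}" and rat: "has_rational_mle S (qi_model m n S)"
    and cyc: "cycle_with_chords (qi_adj S) v L {}" and L: "6 \<le> L"
  shows False
proof -
  interpret bipartite_adjacency "qi_adj S" isl by (rule bipartite_adjacency_qi_adj)
  have inj: "inj_on v {..<L}" using cyc by (simp add: cycle_with_chords_def)
  have adj: "qi_adj S (v i) (v j) \<longleftrightarrow> j = Suc i \<or> (i = 0 \<and> Suc j = L)" if "i < j" "j < L" for i j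
    using cyc that by (simp add: cycle_with_chords_def)
  have adj': "qi_adj S (v j) (v i) \<longleftrightarrow> j = Suc i \<or> (i = 0 \<and> Suc j = L)" if "i < j" "j < L" for i j
    using adj[OF that] sym[of "v i" "v j"] sym[of "v j" "v i"] by blast
  have "qi_adj S (v 0) (v (L - 1))" using adj[of 0 "L - 1"] L by auto
  then have "odd (L - 1)"
    using side[of "v 0" "v (L - 1)"] side_along_cycle[OF cyc, of "L - 1"] L by auto
  then have "even L" using L by simp
  then obtain l where l: "L = 2 * l" by (elim evenE)
  obtain k where k: "l = Suc (Suc (Suc k))"
    using L l by (metis add_2_eq_Suc le_Suc_ex mult_le_cancel1 numeral_3_eq_3 plus_1_eq_Suc
        num_double numeral_times_numeral zero_less_numeral add_Suc)
  \<comment> \<open>Edge number \<open>i\<close> joins the positions \<open>i\<close> and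
    \<open>Suc i\<close>; the closing edge appears as the pair \<open>0\<close>,
    \<open>L - 1\<close> and has number \<open>L - 1\<close>.\<close>
  define d where "d i j = (if j = Suc i then cycle_exponent i else cycle_exponent j)" for i j
  obtain c M K y where c: "0 \<le> K" "\<And>i j. 1 \<le> c i j" "\<And>i j. c i j \<le> M" "\<And>i j. c i j = c j i"
    and ev: "\<forall>\<^sub>F t in sequentially. (\<forall>a. 0 < y t a) \<and>
      (\<forall>i<L. \<bar>\<Sum>j\<in>{j. j < L \<and> qi_adj S (v i) (v j)}.
        y t (v i) * y t (v j) - c i j * real t ^ d (min i j) (max i j)\<bar> \<le> K)"
    and bl: "\<And>i j. qi_adj S (v i) (v j) \<Longrightarrow> bounded_or_linear (\<lambda>t. y t (v i) * y t (v j))"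
    by (rule rational_mle_growth_on_pattern[OF S rat inj, where d = d]) (rule that)
  define nx where "nx i = (if Suc i < L then Suc i else 0)" for i
  \<comment> \<open>Position \<open>L\<close> returns to the first vertex.\<close>
  define z where "z t i = y t (v (if i < L then i else 0))" for t i
  define cc where "cc i = c i (nx i)" for i
  have d_nx: "d (min i (nx i)) (max i (nx i)) = cycle_exponent i" if "i < L" for i
    using that L by (auto simp: d_def nx_def)
  have N: "{j. j < L \<and> qi_adj S (v (Suc i)) (v j)} = {i, nx (Suc i)}" "i \<noteq> nx (Suc i)"
    if i: "Suc i < L" for i
  proof -
    have "qi_adj S (v (Suc i)) (v j) \<longleftrightarrow> j = i \<or> j = nx (Suc i)" if "j < L" for j
    proof -
      consider "j < Suc i" | "j = Suc i" | "Suc i < j" by linarith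
      then show ?thesis
      proof cases
        case 1 then show ?thesis using adj'[OF 1 i] i L by (auto simp: nx_def)
      next
        case 2 then show ?thesis using side[of "v j" "v j"] i by (auto simp: nx_def)
      next
        case 3 then show ?thesis using adj[OF 3 that] i L that by (auto simp: nx_def)
      qed
    qed
    then show "{j. j < L \<and> qi_adj S (v (Suc i)) (v j)} = {i, nx (Suc i)}"
      using i L by (auto simp: nx_def)
    show "i \<noteq> nx (Suc i)" using i L by (auto simp: nx_def)
  qed
  have "\<forall>\<^sub>F t in sequentially. cycle_growth (z t) cc k l K M (real t)"
    using ev eventually_real_ge[of 1]
  proof eventually_elim
    case (elim t)
    have z_nx: "z t (Suc i) = y t (v (nx i))" if "i < L" for i
      using that by (simp add: z_def nx_def)
    show ?case
    proof
      show "l = Suc (Suc (Suc k))" by (rule k)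
      show "1 \<le> cc i" "cc i \<le> M" for i using c by (simp_all add: cc_def)
      show "1 \<le> real t" using elim by simp
      show "0 \<le> K" by (rule c(1))
      show "0 < z t i" for i using elim by (simp add: z_def)
      show "z t (2 * l) = z t 0" using L by (simp add: z_def l)
      fix i assume "Suc i < 2 * l"
      then have i: "Suc i < L" by (simp add: l)
      have "\<bar>\<Sum>j\<in>{j. j < L \<and> qi_adj S (v (Suc i)) (v j)}.
          y t (v (Suc i)) * y t (v j) - c (Suc i) j * real t ^ d (min (Suc i) j) (max (Suc i) j)\<bar> \<le> K"
        using elim i by blast
      then have "\<bar>(y t (v (Suc i)) * y t (v i) - c (Suc i) i * real t ^ cycle_exponent i) +
          (y t (v (Suc i)) * y t (v (nx (Suc i))) - cc (Suc i) * real t ^ cycle_exponent (Suc i))\<bar> \<le> K"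
        unfolding N(1)[OF i] using N(2)[OF i] d_nx[OF i] by (simp add: d_def[of i "Suc i"] cc_def)
      moreover have "z t i = y t (v i)" "z t (Suc i) = y t (v (Suc i))"
        "z t (Suc (Suc i)) = y t (v (nx (Suc i)))" "cc i = c (Suc i) i"
        using i z_nx[OF i] c(4)[of i "Suc i"] by (simp_all add: z_def cc_def nx_def)
      ultimately show "\<bar>(z t i * z t (Suc i) - cc i * real t ^ cycle_exponent i) +
          (z t (Suc i) * z t (Suc (Suc i)) - cc (Suc i) * real t ^ cycle_exponent (Suc i))\<bar> \<le> K"
        by (simp add: mult.commute)
    qed
  qed
  moreover have "bounded_or_linear (\<lambda>t. z t 0 * z t 1)"
    using bl[of 0 1] adj[of 0 1] L by (simp add: z_def)
  ultimately show False by (rule cycle_growth_contradiction)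
qed

lemma not_rational_if_domino:
  assumes S: "S \<subseteq> {1..m} \<times> {1..n}" and rat: "has_rational_mle S (qi_model m n S)"
    and cyc: "cycle_with_chords (qi_adj S) v 6 {(0, 3)}"
  shows False
proof -
  interpret bipartite_adjacency "qi_adj S" isl by (rule bipartite_adjacency_qi_adj)
  have inj: "inj_on v {..<6}" using cyc by (simp add: cycle_with_chords_def)
  have adj: "qi_adj S (v i) (v j) \<longleftrightarrow> j = Suc i \<or> (i = 0 \<and> Suc j = 6) \<or> (i, j) = (0, 3)"
    if "i < j" "j < 6" for i j
    using cyc that by (simp add: cycle_with_chords_def)
  \<comment> \<open>The square on 0, 3, 4, 5 has exponents 2 and 1 on 34 and 05 against 3 on 45,
    which holds edge 03 at order 1. In the other square edge 12 of order \<open>t\<close> faces the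
    product of 01 and 23, which nearly share a deviation, so each is of order
    \<open>sqrt t\<close>.\<close>
  define d :: "nat \<Rightarrow> nat \<Rightarrow> nat" where
    "d i j = (if (i, j) = (4, 5) then 3 else if (i, j) = (3, 4) then 2
      else if (i, j) = (1, 2) \<or> (i, j) = (0, 5) then 1 else 0)" for i j
  obtain c M K y where c: "0 \<le> K" "\<And>i j. 1 \<le> c i j" "\<And>i j. c i j \<le> M" "\<And>i j. c i j = c j i"
    and ev: "\<forall>\<^sub>F t in sequentially. (\<forall>a. 0 < y t a) \<and>
      (\<forall>i<6. \<bar>\<Sum>j\<in>{j. j < 6 \<and> qi_adj S (v i) (v j)}.
        y t (v i) * y t (v j) - c i j * real t ^ d (min i j) (max i j)\<bar> \<le> K)"
    and bl: "\<And>i j. qi_adj S (v i) (v j) \<Longrightarrow> bounded_or_linear (\<lambda>t. y t (v i) * y t (v j))"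
    by (rule rational_mle_growth_on_pattern[OF S rat inj, where d = d]) (rule that)
  define e where "e i j \<longleftrightarrow> (i, j) \<in> {(0, 1), (1, 2), (2, 3), (3, 4), (4, 5), (0, 5), (0, 3 :: nat)}"
    for i j :: nat
  have adj_e: "qi_adj S (v i) (v j) \<longleftrightarrow> e i j \<or> e j i" if "i < 6" "j < 6" for i j
  proof -
    have 1: "qi_adj S (v i) (v j) \<longleftrightarrow> e i j" if "i < j" "j < 6" for i j
    proof -
      have "i = 0 \<or> i = 1 \<or> i = 2 \<or> i = 3 \<or> i = 4" using that by linarith
      then have "(j = Suc i \<or> (i = 0 \<and> Suc j = 6) \<or> (i, j) = (0, 3)) \<longleftrightarrow> e i j"
        by (elim disjE) (auto simp: e_def)
      then show ?thesis using adj[OF that] by simp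
    qed
    have lt: "i < j" if "e i j" for i j using that by (auto simp: e_def)
    consider "i < j" | "i = j" | "j < i" by linarith
    then show ?thesis
    proof cases
      case 1 then show ?thesis using \<open>\<And>j i. i < j \<Longrightarrow> j < 6 \<Longrightarrow> qi_adj S (v i) (v j) \<longleftrightarrow> e i j\<close> that lt[of j i] by auto
    next
      case 2 then show ?thesis using side[of "v i" "v i"] lt[of i i] by auto
    next
      case 3
      have "qi_adj S (v i) (v j) \<longleftrightarrow> qi_adj S (v j) (v i)" using sym by blast
      then show ?thesis using 1[OF 3] that 3 lt[of i j] by auto
    qed
  qed
  have N: "{j. j < 6 \<and> qi_adj S (v i) (v j)} = {j. j < 6 \<and> (e i j \<or> e j i)}" if "i < 6" for i
    using adj_e[OF that] by blast
  have N0: "{j. j < 6 \<and> (e 0 j \<or> e j 0)} = {1, 3, 5}"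
    and N1: "{j. j < 6 \<and> (e 1 j \<or> e j 1)} = {0, 2}"
    and N2: "{j. j < 6 \<and> (e 2 j \<or> e j 2)} = {1, 3}"
    and N3: "{j. j < 6 \<and> (e 3 j \<or> e j 3)} = {0, 2, 4}"
    and N4: "{j. j < 6 \<and> (e 4 j \<or> e j 4)} = {3, 5}"
    and N5: "{j. j < 6 \<and> (e 5 j \<or> e j 5)} = {0, 4}"
    by (auto simp: e_def)
  let ?x = "\<lambda>i j t. y t (v i) * y t (v j)"
  have "\<forall>\<^sub>F t in sequentially. domino_growth (?x 0 1 t) (?x 1 2 t) (?x 2 3 t) (?x 3 4 t) (?x 4 5 t)
      (?x 0 5 t) (?x 0 3 t) (c 0 1) (c 1 2) (c 2 3) (c 3 4) (c 4 5) (c 0 5) (c 0 3) K M (real t)"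
    using ev eventually_real_ge[of 1] eventually_real_ge[of "4 * K + 4 * M"]
  proof eventually_elim
    case (elim t)
    have pos: "0 < y t a" for a using elim(1) by blast
    have marg: "\<bar>\<Sum>j\<in>{j. j < 6 \<and> (e i j \<or> e j i)}.
        y t (v i) * y t (v j) - c i j * real t ^ d (min i j) (max i j)\<bar> \<le> K" if "i < 6" for i
      using elim(1) that unfolding N[OF that, symmetric] by blast
    have c': "c 1 0 = c 0 1" "c 2 1 = c 1 2" "c 3 2 = c 2 3" "c 4 3 = c 3 4" "c 5 4 = c 4 5"
      "c 5 0 = c 0 5" "c 3 0 = c 0 3" by (rule c(4))+
    have x': "?x 1 0 t = ?x 0 1 t" "?x 2 1 t = ?x 1 2 t" "?x 3 2 t = ?x 2 3 t" "?x 4 3 t = ?x 3 4 t"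
      "?x 5 4 t = ?x 4 5 t" "?x 5 0 t = ?x 0 5 t" "?x 3 0 t = ?x 0 3 t" by (rule mult.commute)+
    note m = marg[of 0, unfolded N0] marg[of 1, unfolded N1] marg[of 2, unfolded N2]
      marg[of 3, unfolded N3] marg[of 4, unfolded N4] marg[of 5, unfolded N5]
    show ?case
    proof
      show "\<bar>(?x 0 1 t - c 0 1) + (?x 1 2 t - c 1 2 * real t)\<bar> \<le> K"
        using m(2) by (simp add: d_def c' x' del: One_nat_def)
      show "\<bar>(?x 1 2 t - c 1 2 * real t) + (?x 2 3 t - c 2 3)\<bar> \<le> K"
        using m(3) by (simp add: d_def c' x' del: One_nat_def)
      show "\<bar>(?x 3 4 t - c 3 4 * real t ^ 2) + (?x 4 5 t - c 4 5 * real t ^ 3)\<bar> \<le> K"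
        using m(5) by (simp add: d_def c' x' del: One_nat_def)
      show "\<bar>(?x 4 5 t - c 4 5 * real t ^ 3) + (?x 0 5 t - c 0 5 * real t)\<bar> \<le> K"
        using m(6) by (simp add: d_def c' x' add.commute del: One_nat_def)
      show "\<bar>(?x 0 1 t - c 0 1) + (?x 0 5 t - c 0 5 * real t) + (?x 0 3 t - c 0 3)\<bar> \<le> K"
        using m(1) by (simp add: d_def c' x' add_ac del: One_nat_def)
      show "\<bar>(?x 2 3 t - c 2 3) + (?x 3 4 t - c 3 4 * real t ^ 2) + (?x 0 3 t - c 0 3)\<bar> \<le> K"
        using m(4) by (simp add: d_def c' x' add_ac del: One_nat_def)
    qed (use pos c elim in \<open>simp_all add: mult_ac del: One_nat_def\<close>)
  qed
  moreover have "bounded_or_linear (?x 0 1)" using bl[of 0 1] adj[of 0 1] by simp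
  ultimately show False by (rule domino_growth_contradiction)
qed

theorem theorem1p3:
  fixes m n :: nat and S :: "(nat \<times> nat) set"
  assumes "S \<subseteq> {1..m} \<times> {1..n}"
  shows "has_rational_mle S (qi_model m n S) \<longleftrightarrow>
    doubly_chordal_bipartite (qi_graph m n S)"
  unfolding doubly_chordal_bipartite_iff[OF assms]
  using has_rational_mle_if_distance_hereditary[OF assms]
    not_rational_if_chordless_cycle[OF assms] not_rational_if_domino[OF assms]
  unfolding distance_hereditary_def by blast

end
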